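(* Let $\mathcal Z^+_{\mathrm{reg}},\mathcal Z_{\mathrm{reg}}\subset\mathbb Q[[q]]$ be the algebras of regular multiple $q$-zeta values over $\mathbb Q$, with their weight filtrations, as defined in the context. Then: 1. The algebras $\mathcal Z^+_{\mathrm{reg}}$ and $\mathcal Z_{\mathrm{reg}}$ coincide and are generated (as a $\mathbb Q$-algebra) by the elements $\frac{q^k}{1-q^k}$ for $k\ge1$. 2. The Poincaré series of $\mathcal Z^+_{\mathrm{reg}}$ is $$P(\mathcal Z^+_{\mathrm{reg}},t)=\sum_{i\ge0}\dim\mathrm{gr}^W_i(\mathcal Z^+_{\mathrm{reg}})\,t^i=1+\sum_{d\ge1}d\,t^d=\frac{1-t+t^2}{(1-t)^2}.$$ 3. The Poincaré series of $\mathcal Z_{\mathrm{reg}}$ is $$P(\mathcal Z_{\mathrm{reg}},t)=\sum_{i\ge0}\dim\mathrm{gr}^W_i(\mathcal Z_{\mathrm{reg}})\,t^i=1+\frac1{1-t}\sum_{d\ge1}\phi(d)t^d,$$ where $\phi$ is Euler's totient function. 4. The algebra $\mathcal Z^+_{\mathrm{reg}}$ is spanned over $\mathbb Q$ by the elements $Z^{\mathbf f}(s_1,\dots,s_k)$ with $k\ge0$ and $s_i\in\{1,2\}$ for all $i$.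
   Context: For $f_1,\dots,f_k\in\mathbb Q[q]$ with $f_1\in q\mathbb Q[q]$, put $$Z(f_1\otimes\dots\otimes f_k)=\sum_{n_1>\dots>n_k>0}\prod_{i=1}^kf_i(q^{n_i})\in\mathbb Q[[q]],$$ where the sum runs over strictly decreasing tuples of positive integers; for $k=0$ the value is $1$. For $s=(s_1,\dots,s_k)\in\mathbb N^k$ ($\mathbb N=\{0,1,2,\dots\}$) with $s_1\ge1$ (or $k=0$) put $Z^{\mathbf f}(s_1,\dots,s_k)=Z(q^{s_1}\otimes\dots\otimes q^{s_k})$, with $Z^{\mathbf f}()=1$. $\mathcal Z^+_{\mathrm{reg}}$ is the $\mathbb Q$-span of all $Z^{\mathbf f}(s_1,\dots,s_k)$ with $k\ge0$ and all $s_i\ge1$; $\mathcal Z_{\mathrm{reg}}$ is the $\mathbb Q$-span of all $Z^{\mathbf f}(s_1,\dots,s_k)$ with $k\ge0$, $s_i\ge0$ and $s_1\ge1$ (if $k\geq 1$). Both are subalgebras of $\mathbb Q[[q]]$. Weight filtrations: let $B=\mathbb Q[q]$, $B^+=q\mathbb Q[q]$, $W_0B=0$, $W_kB=\{f\in B:\deg f\le k\}$ for $k\ge1$, and $W_kB^+=B^+\cap W_kB$. For $n\ge0$, $W_n\mathcal Z^+_{\mathrm{reg}}$ is the span of $1$ and all $Z(f_1\otimes\dots\otimes f_k)$ with $k\ge1$, $f_j\in W_{i_j}B^+$ and $i_1+\dots+i_k\le n$; $W_n\mathcal Z_{\mathrm{reg}}$ is the span of $1$ and all $Z(f_1\otimes\dots\otimes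 f_k)$ with $k\ge1$, $f_1\in W_{i_1}B^+$, $f_j\in W_{i_j}B$ for $j\ge2$, and $i_1+\dots+i_k\le n$. (Thus $Z^{\mathbf f}(s_1,\dots,s_k)$ has weight at most $\sum_i\max\{s_i,1\}$.) Finally $\mathrm{gr}^W_i=W_i/W_{i-1}$ with $W_{-1}=0$, and $\dim$ is the dimension over $\mathbb Q$. *)

theory Defs
  imports "HOL-Analysis.Analysis" "HOL-Number_Theory.Totient"
begin

locale quotient_space = vector_space scale
  for scale :: "'a::field \<Rightarrow> 'b::ab_group_add \<Rightarrow> 'b" (infixr \<open>\<odot>\<close> 75)
begin

definition cosets :: "'b set \<Rightarrow> 'b set \<Rightarrow> 'b set set"
  where "cosets V U = (\<lambda>v. v +o U) ` V"

text \<open>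
  A linear combination of elements of \<open>V/U\<close>, with the operations on cosets being the
  elementwise ones. The summand \<open>U\<close> only matters for zero coefficients, where
  scaling a coset elementwise gives \<open>{0}\<close> instead of \<open>U\<close>, and for the empty sum.
\<close>
definition coset_lincomb :: "'b set \<Rightarrow> ('b set \<Rightarrow> 'a) \<Rightarrow> 'b set set \<Rightarrow> 'b set"
  where "coset_lincomb U c B = U + (\<Sum>X\<in>B. (\<lambda>x. c X \<odot> x) ` X)"

definition quotient_basis :: "'b set \<Rightarrow> 'b set \<Rightarrow> 'b set set \<Rightarrow> bool"
  where "quotient_basis V U B \<longleftrightarrow> finite B \<and> B \<subseteq> cosets V U \<and>
    (\<forall>c. coset_lincomb U c B = U \<longrightarrow> (\<forall>X\<in>B. c X = 0)) \<and>
    (\<forall>Y\<in>cosets V U. \<exists>c. Y = coset_lincomb U c B)"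

text \<open>
  As for \<^const>\<open>dim\<close>, the value is \<open>0\<close> if there is no finite basis. All quotients below
  are finite-dimensional.
\<close>
definition quotient_dim :: "'b set \<Rightarrow> 'b set \<Rightarrow> nat"
  where "quotient_dim V U =
    (if \<exists>B. quotient_basis V U B then card (SOME B. quotient_basis V U B) else 0)"

lemma coset_eq_iff:
  assumes "subspace U"
  shows "v +o U = w +o U \<longleftrightarrow> v - w \<in> U"
proof
  assume "v +o U = w +o U"
  moreover have "v \<in> v +o U"
    using subspace_0[OF assms] by (force simp: elt_set_plus_def)
  ultimately show "v - w \<in> U" by (auto simp: elt_set_plus_def)
next
  assume *: "v - w \<in> U"
  have "\<exists>u'\<in>U. v + u = w + u'" if "u \<in> U" for u
    using subspace_add[OF assms * that] by (intro bexI[of _ "v - w + u"]) auto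
  moreover have "\<exists>u'\<in>U. w + u = v + u'" if "u \<in> U" for u
    using subspace_diff[OF assms that *] by (intro bexI[of _ "u - (v - w)"]) auto
  ultimately show "v +o U = w +o U" by (auto simp: elt_set_plus_def)
qed

lemma coset_lincomb_eq:
  assumes U: "subspace U" and "finite B" and "\<And>X. X \<in> B \<Longrightarrow> X = v X +o U"
  shows "coset_lincomb U c B = (\<Sum>X\<in>B. c X \<odot> v X) +o U"
  using assms(2,3)
proof (induction B rule: finite_induct)
  case empty
  then show ?case by (auto simp: coset_lincomb_def elt_set_plus_def set_plus_def)
next
  case (insert X B)
  have img: "(\<lambda>x. c X \<odot> x) ` (w +o U) + U = (c X \<odot> w) +o U" for w
  proof (intro equalityI subsetI)
    fix y assume "y \<in> (\<lambda>x. c X \<odot> x) ` (w +o U) + U"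
    then obtain u u' where u: "u \<in> U" "u' \<in> U" "y = c X \<odot> (w + u) + u'"
      by (auto simp: elt_set_plus_def set_plus_def)
    then have "y = c X \<odot> w + (c X \<odot> u + u')" by (simp add: scale_right_distrib add.assoc)
    moreover have "c X \<odot> u + u' \<in> U" using u by (simp add: subspace_add[OF U] subspace_scale[OF U])
    ultimately show "y \<in> (c X \<odot> w) +o U" by (simp add: set_plus_intro2)
  next
    fix y assume "y \<in> (c X \<odot> w) +o U"
    then obtain u where "u \<in> U" "y = c X \<odot> w + u" by (auto simp: elt_set_plus_def)
    moreover have "w \<in> w +o U" using set_plus_intro2[OF subspace_0[OF U], of w] by simp
    ultimately show "y \<in> (\<lambda>x. c X \<odot> x) ` (w +o U) + U" by blast
  qed
  have 1: "(\<lambda>x. c X \<odot> x) ` X + U = (c X \<odot> v X) +o U"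
    using img[of "v X"] insert.prems[of X] by (metis insertI1)
  have UU: "U + U = U"
    using subspace_add[OF U] subspace_0[OF U] by (force simp: set_plus_def)
  have "coset_lincomb U c (insert X B)
      = U + ((\<lambda>x. c X \<odot> x) ` X + (\<Sum>X\<in>B. (\<lambda>x. c X \<odot> x) ` X))"
    using insert.hyps by (simp add: coset_lincomb_def)
  also have "\<dots> = (U + U) + ((\<lambda>x. c X \<odot> x) ` X + (\<Sum>X\<in>B. (\<lambda>x. c X \<odot> x) ` X))"
    by (simp only: UU)
  also have "\<dots> = ((\<lambda>x. c X \<odot> x) ` X + U) + coset_lincomb U c B"
    unfolding coset_lincomb_def by (simp only: ac_simps)
  also have "\<dots> = ((c X \<odot> v X) +o U) + ((\<Sum>X\<in>B. c X \<odot> v X) +o U)"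
    using insert by (simp add: 1)
  also have "\<dots> = (c X \<odot> v X + (\<Sum>X\<in>B. c X \<odot> v X)) +o U"
    by (simp add: set_plus_rearrange UU)
  finally show ?case using insert.hyps by simp
qed

lemma card_quotient_basis:
  assumes U: "subspace U" and V: "subspace V" and UV: "U \<subseteq> V"
    and F: "finite F" "U \<subseteq> span F"
    and B: "quotient_basis V U B"
  shows "card B + dim U = dim V"
proof -
  have finB: "finite B" and BV: "B \<subseteq> cosets V U"
    and indB: "\<And>c X. coset_lincomb U c B = U \<Longrightarrow> X \<in> B \<Longrightarrow> c X = 0"
    and spanB: "\<And>Y. Y \<in> cosets V U \<Longrightarrow> \<exists>c. Y = coset_lincomb U c B"
    using B unfolding quotient_basis_def by blast+
  define v where "v X = (SOME w. w \<in> V \<and> X = w +o U)" for X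
  have v': "v X \<in> V \<and> X = v X +o U" if "X \<in> B" for X
    unfolding v_def by (rule someI_ex) (use BV that in \<open>auto simp: cosets_def\<close>)
  have v: "\<And>X. X \<in> B \<Longrightarrow> v X \<in> V" "\<And>X. X \<in> B \<Longrightarrow> X = v X +o U"
    by (simp_all only: v'[THEN conjunct1] v'[THEN conjunct2, symmetric])
  note lc = coset_lincomb_eq[OF U finB v(2)]
  have U0: "0 +o U = U" by (auto simp: elt_set_plus_def)
  have ind': "c X = 0" if "(\<Sum>X\<in>B. c X \<odot> v X) \<in> U" "X \<in> B" for c X
  proof (rule indB)
    have "(\<Sum>X\<in>B. c X \<odot> v X) +o U = 0 +o U"
      using that(1) by (intro coset_eq_iff[OF U, THEN iffD2]) simp
    then show "coset_lincomb U c B = U" by (simp only: lc U0)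
  qed (fact that(2))
  have injv: "inj_on v B" by (rule inj_on_inverseI[of B "\<lambda>w. w +o U"]) (rule v(2)[symmetric])
  obtain C where C: "C \<subseteq> U" "independent C" "U \<subseteq> span C" "card C = dim U"
    using basis_exists[of U] by blast
  have finC: "finite C"
    using independent_span_bound[OF F(1) C(2)] C(1) F(2) by blast
  have spanC: "span C = U" using C U by (simp add: span_subspace)
  have disj: "v ` B \<inter> C = {}"
  proof (rule ccontr)
    assume "v ` B \<inter> C \<noteq> {}"
    then obtain X where X: "X \<in> B" "v X \<in> C" by blast
    have "(\<Sum>Y\<in>B. (if Y = X then 1 else 0) \<odot> v Y) = v X"
      using finB X(1) by (simp add: if_distrib[of "\<lambda>c. c \<odot> _"] cong: if_cong)
    then have "(\<Sum>Y\<in>B. (if Y = X then 1 else 0) \<odot> v Y) \<in> U"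
      using C(1) X(2) by auto
    from ind'[OF this X(1)] show False by simp
  qed
  have "independent (v ` B \<union> C)"
  proof (rule independent_if_scalars_zero)
    fix f x assume s: "(\<Sum>x\<in>v ` B \<union> C. f x \<odot> x) = 0" and x: "x \<in> v ` B \<union> C"
    have s': "(\<Sum>X\<in>B. f (v X) \<odot> v X) + (\<Sum>x\<in>C. f x \<odot> x) = 0"
      using s disj finB finC injv by (simp add: sum.union_disjoint sum.reindex)
    have "(\<Sum>x\<in>C. f x \<odot> x) \<in> U"
      using C(1) by (intro subspace_sum[OF U] subspace_scale[OF U]) auto
    then have "(\<Sum>X\<in>B. f (v X) \<odot> v X) \<in> U"
      using s' subspace_neg[OF U] by (metis add_eq_0_iff2)
    then have z: "f (v X) = 0" if "X \<in> B" for X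
      using ind'[of "\<lambda>X. f (v X)"] that by blast
    then have "(\<Sum>x\<in>C. f x \<odot> x) = 0" using s' by simp
    then have "f x = 0" if "x \<in> C" for x
      using independentD[OF C(2) finC] that by blast
    then show "f x = 0" using x z by blast
  qed (use finB finC in auto)
  moreover have "V \<subseteq> span (v ` B \<union> C)"
  proof
    fix w assume "w \<in> V"
    then obtain c where "w +o U = coset_lincomb U c B"
      using spanB[of "w +o U"] unfolding cosets_def by blast
    then have "w - (\<Sum>X\<in>B. c X \<odot> v X) \<in> span C"
      using lc[of c] spanC by (simp add: coset_eq_iff[OF U])
    then have "w - (\<Sum>X\<in>B. c X \<odot> v X) \<in> span (v ` B \<union> C)"
      using span_mono[of C "v ` B \<union> C"] by blast
    moreover have "(\<Sum>X\<in>B. c X \<odot> v X) \<in> span (v ` B \<union> C)"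
      by (intro span_sum span_scale span_base) auto
    ultimately show "w \<in> span (v ` B \<union> C)"
      using span_add[of "w - (\<Sum>X\<in>B. c X \<odot> v X)"] by fastforce
  qed
  moreover have "v ` B \<union> C \<subseteq> V" using v(1) C(1) UV by auto
  ultimately have "card (v ` B \<union> C) = dim V" by (intro basis_card_eq_dim)
  then show ?thesis
    using disj finB finC C(4) injv by (simp add: card_Un_disjoint card_image)
qed

lemma ex_quotient_basis:
  assumes U: "subspace U" and V: "subspace V" and UV: "U \<subseteq> V"
    and F: "finite F" "V \<subseteq> span F"
  shows "\<exists>B. quotient_basis V U B"
proof -
  obtain C where C: "C \<subseteq> U" "independent C" "U \<subseteq> span C" "card C = dim U"
    using basis_exists[of U] by blast
  obtain D where D: "C \<subseteq> D" "D \<subseteq> V" "independent D" "V \<subseteq> span D"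
    using maximal_independent_subset_extend[of C V] C UV by blast
  have finD: "finite D"
    using independent_span_bound[OF F(1) D(3)] D(2) F(2) by blast
  have spanC: "span C = U" using C U by (simp add: span_subspace)
  define E where "E = D - C"
  define B where "B = (\<lambda>v. v +o U) ` E"
  have E: "finite E" "E \<subseteq> V" "E \<inter> C = {}" "E \<union> C = D"
    using finD D by (auto simp: E_def)
  have finC: "finite C" using finD D(1) finite_subset by blast
  have ind: "f x = 0" if "(\<Sum>x\<in>E. f x \<odot> x) \<in> U" "x \<in> E" for f x
  proof -
    obtain g where g: "(\<Sum>x\<in>E. f x \<odot> x) = (\<Sum>x\<in>C. g x \<odot> x)"
      using \<open>_ \<in> U\<close> spanC span_finite[OF finC] by auto
    define h where "h x = (if x \<in> E then f x else - g x)" for x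
    have "(\<Sum>x\<in>D. h x \<odot> x) = (\<Sum>x\<in>E. h x \<odot> x) + (\<Sum>x\<in>C. h x \<odot> x)"
      using E finC by (metis sum.union_disjoint)
    also have "(\<Sum>x\<in>E. h x \<odot> x) = (\<Sum>x\<in>E. f x \<odot> x)" by (simp add: h_def)
    also have "(\<Sum>x\<in>C. h x \<odot> x) = (\<Sum>x\<in>C. - (g x \<odot> x))"
      using E(3) by (intro sum.cong) (auto simp: h_def)
    finally have "(\<Sum>x\<in>D. h x \<odot> x) = 0" using g by (simp add: sum_negf)
    then have "h x = 0" using independentD[OF D(3) finD] that(2) E(4) by blast
    then show ?thesis using that(2) by (simp add: h_def)
  qed
  have inj: "inj_on (\<lambda>v. v +o U) E"
  proof (rule inj_onI, rule ccontr)
    fix x y assume xy: "x \<in> E" "y \<in> E" "x +o U = y +o U" "x \<noteq> y"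
    define f where "f z = (if z = x then 1 else 0) - (if z = y then 1 else (0::'a))" for z
    have "(\<Sum>z\<in>E. f z \<odot> z) = x - y"
      using E(1) xy
      by (simp add: f_def scale_left_diff_distrib sum_subtractf
          if_distrib[of "\<lambda>c. c \<odot> _"] cong: if_cong)
    then have "f x = 0" using ind[of f x] xy coset_eq_iff[OF U] by simp
    then show False using xy(4) by (simp add: f_def)
  qed
  define v where "v = the_inv_into E (\<lambda>v. v +o U)"
  have v: "v (x +o U) = x" if "x \<in> E" for x
    using the_inv_into_f_f[OF inj that] by (simp add: v_def)
  have vB: "X = v X +o U" if "X \<in> B" for X using that v by (auto simp: B_def)
  have finB: "finite B" using E(1) by (simp add: B_def)
  have lc: "coset_lincomb U c B = (\<Sum>x\<in>E. c (x +o U) \<odot> x) +o U" for c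
  proof -
    have "(\<Sum>X\<in>B. c X \<odot> v X) = (\<Sum>x\<in>E. c (x +o U) \<odot> x)"
      using v by (simp add: B_def sum.reindex[OF inj])
    then show ?thesis using coset_lincomb_eq[OF U finB vB] by simp
  qed
  have U0: "0 +o U = U" by (auto simp: elt_set_plus_def)
  have "quotient_basis V U B"
    unfolding quotient_basis_def
  proof (intro conjI allI impI ballI)
    show "finite B" by (fact finB)
    show "B \<subseteq> cosets V U" using E(2) by (auto simp: B_def cosets_def)
  next
    fix c X assume "coset_lincomb U c B = U" "X \<in> B"
    then have "(\<Sum>x\<in>E. c (x +o U) \<odot> x) \<in> U"
      using lc[of c] U0 coset_eq_iff[OF U, of _ 0] by simp
    then show "c X = 0" using ind[of "\<lambda>x. c (x +o U)"] \<open>X \<in> B\<close> by (auto simp: B_def)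
  next
    fix Y assume "Y \<in> cosets V U"
    then obtain w where w: "w \<in> V" "Y = w +o U" by (auto simp: cosets_def)
    then obtain f where f: "w = (\<Sum>x\<in>D. f x \<odot> x)"
      using D(4) span_finite[OF finD] by auto
    have "w = (\<Sum>x\<in>E. f x \<odot> x) + (\<Sum>x\<in>C. f x \<odot> x)"
      using f E finC by (metis sum.union_disjoint)
    moreover have "(\<Sum>x\<in>C. f x \<odot> x) \<in> U"
      using C(1) by (intro subspace_sum[OF U] subspace_scale[OF U]) auto
    ultimately have "Y = (\<Sum>x\<in>E. f x \<odot> x) +o U"
      using w(2) coset_eq_iff[OF U] by simp
    also have "(\<Sum>x\<in>E. f x \<odot> x) = (\<Sum>x\<in>E. f (v (x +o U)) \<odot> x)"
      using v by simp
    finally have "Y = coset_lincomb U (\<lambda>X. f (v X)) B" using lc[of "\<lambda>X. f (v X)"] by simp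
    then show "\<exists>c. Y = coset_lincomb U c B" by blast
  qed
  then show ?thesis by blast
qed

lemma quotient_dim_plus_dim:
  assumes "subspace U" "subspace V" "U \<subseteq> V" "finite F" "V \<subseteq> span F"
  shows "quotient_dim V U + dim U = dim V"
proof -
  have "quotient_basis V U (SOME B. quotient_basis V U B)"
    using ex_quotient_basis[OF assms] by (rule someI_ex)
  then show ?thesis
    using card_quotient_basis[of U V F] ex_quotient_basis[OF assms] assms
    by (auto simp: quotient_dim_def)
qed

end


global_interpretation fps_rat: quotient_space "\<lambda>(c::rat) f. fps_const c * f"
  by unfold_locales
    (simp_all add: algebra_simps flip: fps_const_add fps_const_mult)

definition is_subalgebra :: "rat fps set \<Rightarrow> bool"
  where "is_subalgebra A \<longleftrightarrow> fps_rat.subspace A \<and> 1 \<in> A \<and> (\<forall>f\<in>A. \<forall>g\<in>A. f * g \<in> A)"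


definition decreasing_tuples :: "nat \<Rightarrow> nat list set"
  where "decreasing_tuples k = {ns. length ns = k \<and> sorted_wrt (>) ns \<and> (\<forall>n\<in>set ns. 0 < n)}"

text \<open>
  The list \<open>[f\<^sub>1, \<dots>, f\<^sub>k]\<close> stands for the tensor \<open>f\<^sub>1 \<otimes> \<dots> \<otimes> f\<^sub>k\<close>. The infinite sum is taken
  in the \<open>q\<close>-adic topology, and \<open>f \<circ>\<^sub>p monom 1 n\<close> is \<open>f(q\<^sup>n)\<close>.
\<close>
definition mqz_summand :: "rat poly list \<Rightarrow> nat list \<Rightarrow> rat fps"
  where "mqz_summand fs ns = (\<Prod>i<length fs. fps_of_poly (fs ! i \<circ>\<^sub>p monom 1 (ns ! i)))"

definition mqz :: "rat poly list \<Rightarrow> rat fps"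
  where "mqz fs = (\<Sum>\<^sub>\<infinity>ns\<in>decreasing_tuples (length fs). mqz_summand fs ns)"

definition mqz_mon :: "nat list \<Rightarrow> rat fps"
  where "mqz_mon s = mqz (map (monom 1) s)"

definition Zreg_plus :: "rat fps set"
  where "Zreg_plus = fps_rat.span {mqz_mon s |s. \<forall>i\<in>set s. 1 \<le> i}"

definition Zreg :: "rat fps set"
  where "Zreg = fps_rat.span {mqz_mon s |s. s \<noteq> [] \<longrightarrow> 1 \<le> hd s}"


definition poly_plus :: "rat poly set"
  where "poly_plus = range (\<lambda>f. monom 1 1 * f)"

definition W_poly :: "nat \<Rightarrow> rat poly set"
  where "W_poly k = (if k = 0 then {0} else {f. degree f \<le> k})"

definition W_poly_plus :: "nat \<Rightarrow> rat poly set"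
  where "W_poly_plus k = poly_plus \<inter> W_poly k"

definition W_Zreg_plus :: "nat \<Rightarrow> rat fps set"
  where "W_Zreg_plus n = fps_rat.span (insert 1
    {mqz fs |fs is. fs \<noteq> [] \<and> list_all2 (\<lambda>f i. f \<in> W_poly_plus i) fs is \<and> sum_list is \<le> n})"

definition W_Zreg :: "nat \<Rightarrow> rat fps set"
  where "W_Zreg n = fps_rat.span (insert 1
    {mqz (f # fs) |f fs i is. f \<in> W_poly_plus i \<and>
      list_all2 (\<lambda>f i. f \<in> W_poly i) fs is \<and> i + sum_list is \<le> n})"

definition poincare_series :: "(nat \<Rightarrow> rat fps set) \<Rightarrow> rat fps"
  where "poincare_series W =
    Abs_fps (\<lambda>i. of_nat (fps_rat.quotient_dim (W i) (if i = 0 then {0} else W (i - 1))))"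

lemma mqz_summand_nth_eq_0:
  assumes f: "f \<in> poly_plus" and ns: "ns \<in> decreasing_tuples (Suc (length fs))" and "N < hd ns"
  shows "fps_nth (mqz_summand (f # fs) ns) N = 0"
proof -
  obtain n ms where ns_eq: "ns = n # ms"
    using ns by (cases ns) (auto simp: decreasing_tuples_def)
  obtain g where "f = monom 1 1 * g" using f by (auto simp: poly_plus_def)
  then have "f \<circ>\<^sub>p monom 1 n = monom 1 n * (g \<circ>\<^sub>p monom 1 n)"
    by (simp add: pcompose_mult monom_Suc pcompose_pCons)
  then have "fps_of_poly (f \<circ>\<^sub>p monom 1 n) = fps_X ^ n * fps_of_poly (g \<circ>\<^sub>p monom 1 n)"
    by (simp add: fps_of_poly_mult fps_of_poly_monom')
  then have "mqz_summand (f # fs) ns = fps_X ^ n *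
      (fps_of_poly (g \<circ>\<^sub>p monom 1 n) * mqz_summand fs ms)"
    by (simp add: mqz_summand_def ns_eq prod.lessThan_Suc_shift mult.assoc del: prod.lessThan_Suc)
  then show ?thesis using \<open>N < hd ns\<close> by (simp add: ns_eq fps_X_power_mult_nth)
qed

lemma finite_decreasing_tuples_hd_le:
  "finite {ns \<in> decreasing_tuples (Suc k). hd ns \<le> N}"
proof (rule finite_subset)
  show "{ns \<in> decreasing_tuples (Suc k). hd ns \<le> N} \<subseteq> {ns. set ns \<subseteq> {..N} \<and> length ns = Suc k}"
  proof (clarsimp simp: decreasing_tuples_def)
    fix ns x assume "length ns = Suc k" "sorted_wrt (>) ns" "hd ns \<le> N" "x \<in> set ns"
    then show "x \<le> N" by (cases ns) auto
  qed
qed (simp add: finite_lists_length_eq)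

lemma mqz_has_sum:
  assumes "fs \<noteq> [] \<longrightarrow> hd fs \<in> poly_plus"
  shows "(mqz_summand fs has_sum mqz fs) (decreasing_tuples (length fs))"
proof (cases fs)
  case Nil
  then have "decreasing_tuples (length fs) = {[]}" by (auto simp: decreasing_tuples_def)
  then show ?thesis using has_sum_finite[of "{[]}" "mqz_summand []"] by (simp add: mqz_def Nil)
next
  case (Cons f gs)
  define A where "A = decreasing_tuples (length fs)"
  define S where "S = Abs_fps (\<lambda>N. \<Sum>ns\<in>{ns\<in>A. hd ns \<le> N}. fps_nth (mqz_summand fs ns) N)"
  have "(mqz_summand fs has_sum S) A"
    unfolding has_sum_def tendsto_fps_iff
  proof
    fix N
    let ?F = "{ns\<in>A. hd ns \<le> N}"
    show "\<forall>\<^sub>F X in finite_subsets_at_top A. fps_nth (sum (mqz_summand fs) X) N = fps_nth S N"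
      unfolding eventually_finite_subsets_at_top
    proof (intro exI[of _ ?F] conjI allI impI)
      show "finite ?F" using finite_decreasing_tuples_hd_le by (simp add: A_def Cons)
      fix X assume X: "finite X \<and> ?F \<subseteq> X \<and> X \<subseteq> A"
      have "(\<Sum>ns\<in>X. fps_nth (mqz_summand fs ns) N) = (\<Sum>ns\<in>?F. fps_nth (mqz_summand fs ns) N)"
      proof (rule sum.mono_neutral_right)
        show "\<forall>ns\<in>X - ?F. fps_nth (mqz_summand fs ns) N = 0"
        proof
          fix ns assume "ns \<in> X - ?F"
          then have "ns \<in> A" "N < hd ns" using X by auto
          then show "fps_nth (mqz_summand fs ns) N = 0"
            using mqz_summand_nth_eq_0[of f ns gs N] assms by (simp add: A_def Cons)
        qed
      qed (use X in auto)
      then show "fps_nth (sum (mqz_summand fs) X) N = fps_nth S N"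
        by (simp add: S_def fps_sum_nth)
    qed auto
  qed
  then show ?thesis
    using infsumI[OF \<open>(mqz_summand fs has_sum S) A\<close>] by (simp add: mqz_def A_def)
qed

end

theory Submission
  imports Defs "HOL-Computational_Algebra.Polynomial_Factorial" "HOL-Computational_Algebra.Field_as_Ring"
begin

text \<open>
  Splitting the tuples \<open>n\<^sub>1 > \<dots> > n\<^sub>k\<close> according to whether \<open>n\<^sub>k = 1\<close> shows that
  \<open>Z(s\<^sub>1, \<dots>, s\<^sub>k)\<close> is the product of the series \<open>q\<^sup>m / (1 - q\<^sup>m)\<close> over the partial sums
  \<open>m = s\<^sub>1 + \<dots> + s\<^sub>j\<close>, so everything takes place among rational functions \<open>P / E\<close> with
  \<open>deg P \<le> deg E\<close>. The weight \<open>n\<close> part of \<open>Z\<^sup>+\<close> consists of all such functions with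
  \<open>E = (1 - q) \<dots> (1 - q\<^sup>n)\<close>, and words in \<open>1, 2\<close> already span it. The weight \<open>n\<close> part of
  \<open>Z\<close> consists of all such functions with \<open>E = \<Prod>\<^sub>d \<Phi>\<^sub>d\<^sup>n\<^sup>+\<^sup>1\<^sup>-\<^sup>d\<close>, where \<open>\<Phi>\<^sub>d\<close> are the cyclotomic
  polynomials: a word reaches a multiple of \<open>d\<close> only after weight \<open>d\<close>, and conversely
  partial fractions reduce the claim to the denominators \<open>\<Phi>\<^sub>d\<^sup>j\<close>. Both Poincare series follow by
  counting degrees, and the two algebras agree because \<open>\<Phi>\<^sub>d\<^sup>j\<close> divides \<open>(1 - q) \<dots> (1 - q\<^sup>d\<^sup>j)\<close>.
\<close>

section \<open>Cyclotomic polynomials\<close>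

text \<open>
  The \<open>d\<close>-th cyclotomic polynomial, normalised to have constant coefficient \<open>1\<close> (so \<open>cyc 1 = 1 - q\<close>).
\<close>
function cyc :: "nat \<Rightarrow> rat poly"
  where "cyc n = (1 - monom 1 n) div (\<Prod>d | d dvd n \<and> d < n. cyc d)"
  by auto
termination by (relation "less_than") auto

declare cyc.simps [simp del]

lemma coeff_0_one_minus_monom: "0 < n \<Longrightarrow> coeff (1 - monom 1 n :: rat poly) 0 = 1"
  by simp

lemma degree_one_minus_monom: "degree (1 - monom 1 n :: rat poly) = n"
proof (cases "n = 0")
  case False
  have "degree (- monom 1 n + 1 :: rat poly) = degree (- monom (1::rat) n)"
    by (rule degree_add_eq_left) (use False in \<open>simp add: degree_monom_eq\<close>)
  then show ?thesis by (simp add: degree_monom_eq)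
qed simp

lemma one_minus_monom_nz: "0 < n \<Longrightarrow> (1 - monom 1 n :: rat poly) \<noteq> 0"
  using coeff_0_one_minus_monom[of n] by (metis coeff_0 zero_neq_one)

text \<open>A square factor p * p of f = 1 - q^n makes p divide f' as well, hence also n f - q f',
  which is the nonzero constant n.\<close>

lemma one_minus_monom_squarefree:
  fixes p :: "rat poly"
  assumes "p * p dvd 1 - monom 1 n" "0 < n"
  shows "is_unit p"
proof -
  define f :: "rat poly" where "f = 1 - monom 1 n"
  obtain g where g: "f = p * p * g" using assms(1) by (auto simp: f_def)
  have "p dvd f" using g by simp
  moreover have "p dvd pderiv f" unfolding g pderiv_mult by (intro dvd_add) auto
  ultimately have "p dvd smult (of_nat n) f - monom 1 1 * pderiv f"
    by (intro dvd_diff dvd_smult dvd_mult)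
  also have "pderiv f = - monom (of_nat n) (n - 1)"
    by (simp add: f_def pderiv_diff pderiv_monom)
  also have "smult (of_nat n) f - monom 1 1 * - monom (of_nat n) (n - 1) = [:of_nat n:]"
    using assms(2)
    by (simp only: f_def mult_minus_right mult_monom smult_diff_right smult_monom smult_one) simp
  finally show "is_unit p"
    by (rule dvd_unit_imp_unit) (use assms(2) in \<open>simp add: is_unit_const_poly_iff dvd_field_iff\<close>)
qed

lemma one_minus_monom_dvd:
  assumes "m dvd n" shows "(1 - monom 1 m :: rat poly) dvd 1 - monom 1 n"
proof -
  obtain k where "n = m * k" using assms by auto
  then have "(1 - monom 1 n :: rat poly) = 1 ^ k - monom 1 m ^ k" by (simp add: monom_power)
  also have "1 - monom 1 m dvd \<dots>" by (subst power_diff_sumr2) simp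
  finally show ?thesis .
qed

text \<open>Euclid's algorithm on the exponents: with r = m mod n, 1 - q^r equals (1 - q^m) - q^r (1
  - q^(m - r)), and the last factor is a multiple of 1 - q^n.\<close>

lemma dvd_one_minus_monom_gcd:
  fixes p :: "rat poly"
  assumes "p dvd 1 - monom 1 a" "p dvd 1 - monom 1 b"
  shows "p dvd 1 - monom 1 (gcd a b)"
  using assms
proof (induction a b rule: gcd_nat_induct)
  case (step m n)
  have "monom 1 m = monom (1::rat) (n * (m div n)) * monom 1 (m mod n)"
    by (subst mult_monom) simp
  then have "(1 - monom 1 (m mod n) :: rat poly) =
      (1 - monom 1 m) - monom 1 (m mod n) * (1 - monom 1 (n * (m div n)))"
    by (simp only: right_diff_distrib) simp
  moreover have "p dvd 1 - monom 1 (n * (m div n))"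
    using step.prems(2) one_minus_monom_dvd[OF dvd_triv_left] by (rule dvd_trans)
  ultimately have "p dvd 1 - monom 1 (m mod n)"
    using step.prems(1) by (simp only: dvd_diff dvd_mult)
  then show ?case
    unfolding gcd_red_nat[of m n] by (rule step.IH[OF step.prems(2)])
qed simp

lemma prod_dvd_pairwise_coprime:
  fixes f :: "'a \<Rightarrow> rat poly"
  assumes "finite A" "\<And>x. x \<in> A \<Longrightarrow> f x dvd c"
    "\<And>x y. x \<in> A \<Longrightarrow> y \<in> A \<Longrightarrow> x \<noteq> y \<Longrightarrow> coprime (f x) (f y)"
  shows "prod f A dvd c"
  using assms
proof (induction A rule: finite_induct)
  case (insert x A)
  have "coprime (f x) (prod f A)"
    using insert.hyps by (intro prod_coprime_right insert.prems(2)) auto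
  then show ?case using insert by (simp add: divides_mult)
qed simp

text \<open>The product formula is assumed only below n because this lemma serves inside the
  induction that proves it. A common factor p of \<open>cyc a\<close> and \<open>cyc b\<close>
  divides 1 - q^g with g = gcd a b. If g < a, then \<open>cyc a\<close> times the product for g
  still divides 1 - q^a, so p * p divides a squarefree polynomial.\<close>

lemma coprime_cyc_aux:
  assumes P: "\<And>m. 0 < m \<Longrightarrow> m < n \<Longrightarrow> (\<Prod>d | d dvd m. cyc d) = 1 - monom 1 m"
    and ab: "0 < a" "a < n" "0 < b" "b < n" "a \<noteq> b"
  shows "coprime (cyc a) (cyc b)"
proof -
  have *: "coprime (cyc a) (cyc b)" if "0 < a" "a < n" "0 < b" "b < n" "gcd a b < a" for a b
  proof (rule coprimeI)
    fix p assume p: "p dvd cyc a" "p dvd cyc b"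
    let ?g = "gcd a b"
    have fin: "finite {d. d dvd a}" using that by simp
    have g: "0 < ?g" "?g < n" using that by auto
    have cd: "cyc c dvd 1 - monom 1 c" if "0 < c" "c < n" for c
    proof -
      have "finite {d. d dvd c}" using that by simp
      then show ?thesis unfolding P[OF that, symmetric] by (intro dvd_prodI) auto
    qed
    have "p dvd 1 - monom 1 ?g"
      using p cd[of a] cd[of b] that by (intro dvd_one_minus_monom_gcd) (auto dest: dvd_trans)
    then have "p * p dvd cyc a * (\<Prod>d | d dvd ?g. cyc d)"
      unfolding P[OF g] using p by (intro mult_dvd_mono)
    also have "\<dots> = (\<Prod>d \<in> insert a {d. d dvd ?g}. cyc d)"
      using that g by (subst prod.insert) (auto dest: dvd_imp_le)
    also have "\<dots> dvd (\<Prod>d | d dvd a. cyc d)"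
      using fin by (intro prod_dvd_prod_subset) (auto intro: dvd_trans)
    also have "\<dots> = 1 - monom 1 a" using that by (intro P)
    finally show "is_unit p" using that(1) by (rule one_minus_monom_squarefree)
  qed
  \<comment> \<open>The claim \<open>*\<close> wants the gcd strictly below its first argument; as a
    and b differ, one of the two orders qualifies.\<close>
  have "gcd a b < a \<or> gcd b a < b"
    using ab gcd_le1_nat[of a b] gcd_le2_nat[of b a] gcd.commute[of a b] by linarith
  then show ?thesis using *[of a b] *[of b a] ab by (auto simp: coprime_commute)
qed

text \<open>The point is that the division defining \<open>cyc n\<close> is exact: for proper
  divisors d of n, the polynomials \<open>cyc d\<close> are pairwise coprime and each divides 1 -
  q^n, so their product does too.\<close>

theorem prod_cyc:
  assumes "0 < n" shows "(\<Prod>d | d dvd n. cyc d) = 1 - monom 1 n"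
  using assms
proof (induction n rule: less_induct)
  case (less n)
  let ?P = "\<Prod>d | d dvd n \<and> d < n. cyc d"
  have fin: "finite {d. d dvd n}" using less.prems by simp
  have pos: "0 < d" if "d dvd n" for d using that less.prems by (auto intro: Nat.gr0I)
  have "?P dvd 1 - monom 1 n"
  proof (rule prod_dvd_pairwise_coprime)
    fix d assume d: "d \<in> {d. d dvd n \<and> d < n}"
    then have "finite {e. e dvd d}" using pos by simp
    then have "cyc d dvd (\<Prod>e | e dvd d. cyc e)" by (intro dvd_prodI) auto
    also have "\<dots> = 1 - monom 1 d" using d pos by (intro less.IH) auto
    also have "\<dots> dvd 1 - monom 1 n" using d by (intro one_minus_monom_dvd) auto
    finally show "cyc d dvd 1 - monom 1 n" .
  next
    fix a b assume "a \<in> {d. d dvd n \<and> d < n}" "b \<in> {d. d dvd n \<and> d < n}" "a \<noteq> b"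
    then show "coprime (cyc a) (cyc b)"
      using coprime_cyc_aux[of n a b] less.IH pos by auto
  qed (use fin in auto)
  then have "cyc n * ?P = 1 - monom 1 n" by (subst cyc.simps) simp
  moreover have "{d. d dvd n} = insert n {d. d dvd n \<and> d < n}"
    using less.prems by (auto dest: dvd_imp_le simp: le_less)
  ultimately show ?case using fin by simp
qed

lemma coprime_cyc: "0 < a \<Longrightarrow> 0 < b \<Longrightarrow> a \<noteq> b \<Longrightarrow> coprime (cyc a) (cyc b)"
  using coprime_cyc_aux[of "Suc (a + b)" a b] prod_cyc by simp

lemma cyc_dvd: "0 < n \<Longrightarrow> cyc n dvd 1 - monom 1 n"
  unfolding prod_cyc[symmetric] by (intro dvd_prodI) auto

lemma coeff_0_cyc: "0 < n \<Longrightarrow> coeff (cyc n) 0 \<noteq> 0"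
proof
  assume n: "0 < n" and 0: "coeff (cyc n) 0 = 0"
  obtain g where "1 - monom 1 n = cyc n * g" using cyc_dvd[OF n] by (rule dvdE)
  then have "coeff (1 - monom 1 n :: rat poly) 0 = coeff (cyc n) 0 * coeff g 0"
    by (simp only: coeff_mult_0)
  then show False using n 0 by (simp only: coeff_0_one_minus_monom)
qed

lemma cyc_nz: "0 < n \<Longrightarrow> cyc n \<noteq> 0"
  by (metis coeff_0 coeff_0_cyc)

text \<open>Degrees in the product formula are compared with the identity that the totients of the
  divisors of n add up to n; by induction the proper divisors cancel.\<close>

lemma degree_cyc: "0 < n \<Longrightarrow> degree (cyc n) = totient n"
proof (induction n rule: less_induct)
  case (less n)
  have fin: "finite {d. d dvd n}" using less.prems by simp
  have pos: "0 < d" if "d dvd n" for d using that less.prems by (auto intro: Nat.gr0I)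
  have eq: "{d. d dvd n} = insert n {d. d dvd n \<and> d < n}"
    using less.prems by (auto dest: dvd_imp_le simp: le_less)
  have "(\<Sum>d | d dvd n. degree (cyc d)) = degree (\<Prod>d | d dvd n. cyc d)"
    using pos cyc_nz by (subst degree_prod_eq_sum_degree) auto
  also have "\<dots> = n" using less.prems by (simp add: prod_cyc degree_one_minus_monom)
  also have "\<dots> = (\<Sum>d | d dvd n. totient d)" by (simp add: totient_divisor_sum)
  finally have "degree (cyc n) + (\<Sum>d | d dvd n \<and> d < n. degree (cyc d)) =
      totient n + (\<Sum>d | d dvd n \<and> d < n. totient d)"
    unfolding eq using fin by simp
  moreover have "(\<Sum>d | d dvd n \<and> d < n. degree (cyc d)) = (\<Sum>d | d dvd n \<and> d < n. totient d)"
    using less.IH pos by (intro sum.cong) auto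
  ultimately show ?case by simp
qed

section \<open>Rational functions without pole at infinity\<close>

text \<open>The equation avoids division, and P / E need not be in lowest terms, so passing to a
  multiple of E enlarges the space.\<close>

definition ratfun :: "rat poly \<Rightarrow> rat fps set"
  where "ratfun E = {f. \<exists>P. degree P \<le> degree E \<and> f * fps_of_poly E = fps_of_poly P}"

lemma ratfunI: "degree P \<le> degree E \<Longrightarrow> f * fps_of_poly E = fps_of_poly P \<Longrightarrow> f \<in> ratfun E"
  unfolding ratfun_def by blast

lemma ratfunE:
  assumes "f \<in> ratfun E"
  obtains P where "degree P \<le> degree E" "f * fps_of_poly E = fps_of_poly P"
  using assms unfolding ratfun_def by blast

lemma fps_inverse_mult_cancel:
  fixes E :: "rat poly"
  assumes "coeff E 0 \<noteq> 0"
  shows "inverse (fps_of_poly E) * fps_of_poly E = 1"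
  using assms by (intro inverse_mult_eq_1) simp

lemma ratfun_inverse:
  assumes "coeff E 0 \<noteq> 0" "degree P \<le> degree E"
  shows "fps_of_poly P * inverse (fps_of_poly E) \<in> ratfun E"
  by (rule ratfunI[OF assms(2)]) (simp only: mult.assoc fps_inverse_mult_cancel[OF assms(1)] mult_1_right)

lemma subspace_ratfun: "fps_rat.subspace (ratfun E)"
proof (rule fps_rat.subspaceI)
  show "0 \<in> ratfun E" by (rule ratfunI[of 0]) auto
next
  fix f g assume "f \<in> ratfun E" "g \<in> ratfun E"
  then obtain P Q where "degree P \<le> degree E" "f * fps_of_poly E = fps_of_poly P"
      "degree Q \<le> degree E" "g * fps_of_poly E = fps_of_poly Q"
    by (elim ratfunE)
  then show "f + g \<in> ratfun E"
    by (intro ratfunI[of "P + Q"]) (simp_all add: degree_add_le distrib_right fps_of_poly_add)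
next
  fix c f assume "f \<in> ratfun E"
  then obtain P where "degree P \<le> degree E" "f * fps_of_poly E = fps_of_poly P" by (elim ratfunE)
  then show "fps_const c * f \<in> ratfun E"
    by (intro ratfunI[of "smult c P"]) (simp_all add: degree_smult_le[THEN order_trans] mult.assoc fps_of_poly_smult)
qed

lemma ratfun_1: "ratfun 1 = fps_rat.span {1}"
proof -
  have "f \<in> ratfun 1 \<longleftrightarrow> (\<exists>c. f = fps_const c)" for f
  proof
    assume "f \<in> ratfun 1"
    then obtain P where P: "degree P \<le> 0" "f = fps_of_poly P" by (elim ratfunE) simp
    then obtain c where "P = [:c:]" by (auto elim: degree_eq_zeroE)
    then show "\<exists>c. f = fps_const c" using P by (auto simp: fps_of_poly_const)
  next
    assume "\<exists>c. f = fps_const c"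
    then obtain c where "f = fps_const c" ..
    then show "f \<in> ratfun 1" by (intro ratfunI[of "[:c:]"]) (simp_all add: fps_of_poly_const)
  qed
  then show ?thesis by (auto simp: fps_rat.span_singleton)
qed

lemma ratfun_mono:
  assumes "E dvd F" "F \<noteq> 0"
  shows "ratfun E \<subseteq> ratfun F"
proof
  fix f assume "f \<in> ratfun E"
  then obtain P where P: "degree P \<le> degree E" "f * fps_of_poly E = fps_of_poly P" by (elim ratfunE)
  obtain K where K: "F = E * K" using assms(1) by (rule dvdE)
  have "degree (P * K) \<le> degree F"
    using degree_mult_le[of P K] P(1) assms(2) by (auto simp: K degree_mult_eq)
  moreover have "f * fps_of_poly F = fps_of_poly (P * K)"
    by (simp only: K fps_of_poly_mult mult.assoc[symmetric] P(2))
  ultimately show "f \<in> ratfun F" by (rule ratfunI)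
qed

lemma ratfun_mult:
  assumes "f \<in> ratfun E" "g \<in> ratfun F" "E \<noteq> 0" "F \<noteq> 0"
  shows "f * g \<in> ratfun (E * F)"
proof -
  obtain P Q where P: "degree P \<le> degree E" "f * fps_of_poly E = fps_of_poly P"
      and Q: "degree Q \<le> degree F" "g * fps_of_poly F = fps_of_poly Q"
    using assms(1,2) by (elim ratfunE)
  have "degree (P * Q) \<le> degree (E * F)"
    using degree_mult_le[of P Q] P(1) Q(1) assms by (simp add: degree_mult_eq)
  moreover have "f * g * fps_of_poly (E * F) = (f * fps_of_poly E) * (g * fps_of_poly F)"
    by (simp only: fps_of_poly_mult mult_ac)
  then have "f * g * fps_of_poly (E * F) = fps_of_poly (P * Q)"
    by (simp only: P(2) Q(2) fps_of_poly_mult)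
  ultimately show ?thesis by (rule ratfunI)
qed

text \<open>Partial fractions in which both summands stay regular at infinity. The numerator over A
  is bounded by reduction modulo A; the bound for the other one, w, follows from A w = P - r
  B.\<close>

lemma ratfun_mult_coprime:
  assumes "coprime A B" "coeff A 0 \<noteq> 0" "coeff B 0 \<noteq> 0" "f \<in> ratfun (A * B)"
  shows "\<exists>g\<in>ratfun A. \<exists>h\<in>ratfun B. f = g + h"
proof -
  have nz: "A \<noteq> 0" "B \<noteq> 0" using assms(2,3) by (metis coeff_0)+
  obtain P where P: "degree P \<le> degree A + degree B" "f * fps_of_poly (A * B) = fps_of_poly P"
    using assms(4) nz by (elim ratfunE) (simp add: degree_mult_eq)
  obtain u v where uv: "u * A + v * B = 1"
    using bezout_coefficients_fst_snd[of A B] assms(1) by (metis coprime_iff_gcd_eq_1)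
  \<comment> \<open>From P = P u A + P v B, the remainder of P v modulo A stays over A and the
    quotient moves into the numerator over B.\<close>
  define r w where "r = (P * v) mod A" and "w = (P * v) div A * B + P * u"
  have "P = P * (u * A + v * B)" by (simp only: uv mult_1_right)
  also have "\<dots> = P * u * A + ((P * v) div A * A + r) * B"
    unfolding r_def div_mult_mod_eq by (simp only: distrib_left mult.assoc)
  also have "\<dots> = r * B + A * w" unfolding w_def by (simp only: distrib_left distrib_right mult_ac add_ac)
  finally have Prw: "P = r * B + A * w" .
  have r: "degree r \<le> degree A"
    unfolding r_def using degree_mod_less[OF nz(1), of "P * v"] by auto
  have "A * w = P - r * B" using Prw by simp
  then have "degree (A * w) \<le> degree A + degree B"
    using P(1) degree_mult_le[of r B] r by (metis (no_types, lifting) add_le_mono1 degree_diff_le order_trans)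
  then have w: "degree w \<le> degree B"
    using nz by (cases "w = 0") (simp_all add: degree_mult_eq)
  let ?A = "fps_of_poly A" and ?B = "fps_of_poly B"
  define g h where "g = fps_of_poly r * inverse ?A" and "h = fps_of_poly w * inverse ?B"
  have g: "g * ?A = fps_of_poly r" and h: "h * ?B = fps_of_poly w"
    by (simp_all only: g_def h_def mult.assoc fps_inverse_mult_cancel assms mult_1_right not_False_eq_True)
  have "(g + h) * (?A * ?B) = (g * ?A) * ?B + ?A * (h * ?B)" by (simp only: distrib_left distrib_right mult_ac)
  also have "\<dots> = f * (?A * ?B)"
    using P(2) unfolding g h by (simp only: Prw fps_of_poly_add fps_of_poly_mult)
  finally have "f = g + h" using nz by (metis mult_cancel_right no_zero_divisors fps_of_poly_eq_iff fps_of_poly_0)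
  moreover have "g \<in> ratfun A" "h \<in> ratfun B" using r w g h by (auto intro: ratfunI)
  ultimately show ?thesis by blast
qed

lemma coeff_0_prod_nz:
  fixes f :: "'a \<Rightarrow> rat poly"
  shows "(\<And>x. x \<in> A \<Longrightarrow> coeff (f x) 0 \<noteq> 0) \<Longrightarrow> coeff (prod f A) 0 \<noteq> 0"
  by (induction A rule: infinite_finite_induct) (simp_all add: coeff_mult_0)

text \<open>Partial fractions, iterated. The assumption 1 \<in> V settles the empty product, for
  which only constants remain.\<close>

lemma ratfun_prod_subset:
  assumes V: "fps_rat.subspace V" "1 \<in> V"
    and A: "\<And>x y. x \<in> A \<Longrightarrow> y \<in> A \<Longrightarrow> x \<noteq> y \<Longrightarrow> coprime (f x) (f y)"
      "\<And>x. x \<in> A \<Longrightarrow> coeff (f x) 0 \<noteq> 0" "\<And>x. x \<in> A \<Longrightarrow> ratfun (f x) \<subseteq> V"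
  shows "ratfun (prod f A) \<subseteq> V"
proof -
  have 1: "ratfun 1 \<subseteq> V" unfolding ratfun_1 using V by (intro fps_rat.span_minimal) auto
  show ?thesis
    using A
  proof (induction A rule: infinite_finite_induct)
    case (insert x A)
    show ?case
    proof
      fix h assume h: "h \<in> ratfun (prod f (insert x A))"
      have "coprime (f x) (prod f A)"
        using insert.hyps by (intro prod_coprime_right insert.prems(1)) auto
      moreover have "coeff (prod f A) 0 \<noteq> 0" using insert.prems by (intro coeff_0_prod_nz) auto
      ultimately obtain a b where "a \<in> ratfun (f x)" "b \<in> ratfun (prod f A)" "h = a + b"
        using ratfun_mult_coprime[of "f x" "prod f A" h] insert.hyps insert.prems(2) h by auto
      moreover have "ratfun (prod f A) \<subseteq> V" using insert.prems by (intro insert.IH) auto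
      ultimately show "h \<in> V" using insert.prems(3)[of x] fps_rat.subspace_add[OF V(1)] by blast
    qed
  qed (use 1 in simp_all)
qed

text \<open>Multiplication by E turns \<open>b i\<close> into q^i, so spanning and independence are
  those of monomials. Numerators of degree 0 up to \<open>degree E\<close> are allowed, which
  accounts for the extra 1 in the dimension.\<close>

lemma ratfun_basis:
  fixes E :: "rat poly"
  defines "b \<equiv> \<lambda>i. fps_X ^ i * inverse (fps_of_poly E)"
  assumes E: "coeff E 0 \<noteq> 0"
  shows "ratfun E = fps_rat.span (b ` {..degree E})" "fps_rat.dim (ratfun E) = degree E + 1"
proof -
  let ?E = "fps_of_poly E"
  have bE: "b i * ?E = fps_X ^ i" for i
    by (simp only: b_def mult.assoc fps_inverse_mult_cancel[OF E] mult_1_right)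
  have sumE: "(\<Sum>i\<le>n. fps_const (c i) * b i) * ?E = fps_of_poly (\<Sum>i\<le>n. monom (c i) i)" for c n
    by (simp only: sum_distrib_right mult.assoc bE fps_of_poly_sum fps_of_poly_monom)
  have deg: "degree (\<Sum>i\<le>n. monom (c i) i :: rat poly) \<le> n" for c n
    by (intro degree_sum_le) (auto intro: order_trans[OF degree_monom_le])
  show span: "ratfun E = fps_rat.span (b ` {..degree E})"
  proof
    show "ratfun E \<subseteq> fps_rat.span (b ` {..degree E})"
    proof
      fix f assume "f \<in> ratfun E"
      then obtain P where P: "degree P \<le> degree E" "f * ?E = fps_of_poly P" by (elim ratfunE)
      have "P = (\<Sum>i\<le>degree E. monom (coeff P i) i)"
        using poly_as_sum_of_monoms'[OF P(1)] by simp
      then have "f * ?E = (\<Sum>i\<le>degree E. fps_const (coeff P i) * b i) * ?E"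
        using P(2) by (simp only: sumE)
      then have "f = (\<Sum>i\<le>degree E. fps_const (coeff P i) * b i)"
        using E by (metis coeff_0 fps_of_poly_0 fps_of_poly_eq_iff mult_cancel_right)
      also have "\<dots> \<in> fps_rat.span (b ` {..degree E})"
        by (intro fps_rat.span_sum fps_rat.span_scale fps_rat.span_base) auto
      finally show "f \<in> fps_rat.span (b ` {..degree E})" .
    qed
    show "fps_rat.span (b ` {..degree E}) \<subseteq> ratfun E"
    proof (rule fps_rat.span_minimal[OF _ subspace_ratfun], safe)
      fix i assume "i \<le> degree E"
      then show "b i \<in> ratfun E"
        by (intro ratfunI[of "monom 1 i"]) (simp_all add: degree_monom_eq bE fps_of_poly_monom')
    qed
  qed
  have inj: "inj b"
  proof (rule injI)
    fix i j assume "b i = b j"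
    then have "fps_X ^ i = (fps_X ^ j :: rat fps)" using bE by metis
    then have "fps_nth (fps_X ^ i :: rat fps) j = 1" by simp
    then show "i = j" by (simp split: if_splits)
  qed
  have "fps_rat.independent (b ` {..degree E})"
  proof (rule fps_rat.independent_if_scalars_zero)
    fix f x assume s: "(\<Sum>x\<in>b ` {..degree E}. fps_const (f x) * x) = 0" and x: "x \<in> b ` {..degree E}"
    have "(\<Sum>i\<le>degree E. fps_const (f (b i)) * b i) = 0"
      using s inj by (simp add: sum.reindex inj_on_subset[of b UNIV])
    then have "fps_of_poly (\<Sum>i\<le>degree E. monom (f (b i)) i) = 0"
      unfolding sumE[symmetric] by simp
    then have "(\<Sum>i\<le>degree E. monom (f (b i)) i) = 0" by (metis fps_of_poly_0 fps_of_poly_eq_iff)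
    moreover obtain j where j: "j \<le> degree E" "x = b j" using x by auto
    ultimately have "coeff (\<Sum>i\<le>degree E. monom (f (b i)) i) j = 0" by simp
    then show "f x = 0" using j by (simp add: coeff_sum)
  qed simp
  then have "fps_rat.dim (b ` {..degree E}) = card (b ` {..degree E})"
    by (rule fps_rat.dim_eq_card_independent)
  also have "\<dots> = degree E + 1" using inj by (simp add: card_image inj_on_subset[of b UNIV])
  finally show "fps_rat.dim (ratfun E) = degree E + 1" by (simp add: span)
qed

section \<open>Recursion for multiple $q$-zeta values\<close>

lemma has_sum_fps_add:
  fixes F G :: "'a \<Rightarrow> rat fps"
  assumes "(F has_sum S) A" "(G has_sum T) A"
  shows "((\<lambda>x. F x + G x) has_sum (S + T)) A"
  unfolding has_sum_def tendsto_fps_iff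
proof
  fix N
  have "\<forall>\<^sub>F X in finite_subsets_at_top A. fps_nth (sum F X) N = fps_nth S N"
    "\<forall>\<^sub>F X in finite_subsets_at_top A. fps_nth (sum G X) N = fps_nth T N"
    using assms unfolding has_sum_def tendsto_fps_iff by blast+
  then show "\<forall>\<^sub>F X in finite_subsets_at_top A. fps_nth (\<Sum>x\<in>X. F x + G x) N = fps_nth (S + T) N"
    by eventually_elim (simp add: sum.distrib)
qed

text \<open>Coefficient N of a product involves only the coefficients up to N, so finitely many
  eventual equalities suffice.\<close>

lemma has_sum_fps_cmult:
  fixes F :: "'a \<Rightarrow> rat fps"
  assumes "(F has_sum S) A"
  shows "((\<lambda>x. c * F x) has_sum (c * S)) A"
  unfolding has_sum_def tendsto_fps_iff
proof
  fix N
  have "\<forall>\<^sub>F X in finite_subsets_at_top A. \<forall>k\<in>{..N}. fps_nth (sum F X) k = fps_nth S k"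
    using assms unfolding has_sum_def tendsto_fps_iff by (intro eventually_ball_finite) auto
  then show "\<forall>\<^sub>F X in finite_subsets_at_top A. fps_nth (\<Sum>x\<in>X. c * F x) N = fps_nth (c * S) N"
  proof eventually_elim
    case (elim X)
    have "fps_nth (\<Sum>x\<in>X. c * F x) N = fps_nth (c * sum F X) N" by (simp only: sum_distrib_left)
    also have "\<dots> = fps_nth (c * S) N" using elim by (simp only: fps_mult_nth) (intro sum.cong, auto)
    finally show ?case .
  qed
qed

lemma has_sum_fps_lincomb:
  fixes F :: "'b \<Rightarrow> 'a \<Rightarrow> rat fps"
  assumes "finite J" "\<And>j. j \<in> J \<Longrightarrow> (F j has_sum S j) A"
  shows "((\<lambda>x. \<Sum>j\<in>J. c j * F j x) has_sum (\<Sum>j\<in>J. c j * S j)) A"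
  using assms
proof (induction J rule: finite_induct)
  case (insert j J)
  then show ?case by (simp add: has_sum_fps_add has_sum_fps_cmult)
qed (simp add: has_sum_0)

lemma has_sum_fps_Un_disjoint:
  fixes F :: "'a \<Rightarrow> rat fps"
  assumes F: "(F has_sum S) A" "(F has_sum T) B" and "A \<inter> B = {}"
  shows "(F has_sum (S + T)) (A \<union> B)"
proof (rule has_sum_fpsI)
  fix n
  note D = has_sum_fpsD[OF F(1), of n] has_sum_fpsD[OF F(2), of n]
  have eq: "{x \<in> A \<union> B. fps_nth (F x) n \<noteq> 0} =
      {x \<in> A. fps_nth (F x) n \<noteq> 0} \<union> {x \<in> B. fps_nth (F x) n \<noteq> 0}" by blast
  then show "finite {x \<in> A \<union> B. fps_nth (F x) n \<noteq> 0}" using D by simp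
  show "fps_nth (S + T) n = (\<Sum>x | x \<in> A \<union> B \<and> fps_nth (F x) n \<noteq> 0. fps_nth (F x) n)"
    unfolding eq fps_add_nth D(2,4)
    by (rule sum.union_disjoint[symmetric]) (use D assms(3) in auto)
qed

section \<open>Linearity in each tensor slot and splitting of the tuples\<close>

lemma mqz_lincomb:
  assumes "finite J" "\<And>j. j \<in> J \<Longrightarrow> hd (us @ p j # vs) \<in> poly_plus"
  shows "mqz (us @ (\<Sum>j\<in>J. smult (c j) (p j)) # vs) = (\<Sum>j\<in>J. fps_const (c j) * mqz (us @ p j # vs))"
proof -
  let ?k = "length us" and ?f = "\<Sum>j\<in>J. smult (c j) (p j)"
  let ?A = "decreasing_tuples (length us + length vs + 1)"
  \<comment> \<open>\<open>K\<close> collects the factors outside slot \<open>?k\<close>, so the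
    entry 0 placed there is only a filler and \<open>K\<close> is the same for every choice of that
    slot.\<close>
  define K where "K ns = (\<Prod>i\<in>{..<length us + length vs + 1} - {?k}.
      fps_of_poly ((us @ 0 # vs) ! i \<circ>\<^sub>p monom 1 (ns ! i)))" for ns
  have K: "mqz_summand (us @ f # vs) ns = fps_of_poly (f \<circ>\<^sub>p monom 1 (ns ! ?k)) * K ns" for f ns
  proof -
    have "(us @ f # vs) ! i = (us @ 0 # vs) ! i" if "i \<noteq> ?k" for i
      using that by (auto simp: nth_append nth_Cons')
    then show ?thesis
      unfolding mqz_summand_def K_def by (subst prod.remove[of _ ?k]) auto
  qed
  have "mqz_summand (us @ ?f # vs) ns = (\<Sum>j\<in>J. fps_const (c j) * mqz_summand (us @ p j # vs) ns)" for ns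
    unfolding K by (simp add: pcompose_sum pcompose_smult fps_of_poly_sum fps_of_poly_smult
        sum_distrib_right mult.assoc)
  moreover have "((\<lambda>ns. \<Sum>j\<in>J. fps_const (c j) * mqz_summand (us @ p j # vs) ns) has_sum
      (\<Sum>j\<in>J. fps_const (c j) * mqz (us @ p j # vs))) ?A"
  proof (rule has_sum_fps_lincomb[OF assms(1)])
    show "(mqz_summand (us @ p j # vs) has_sum mqz (us @ p j # vs)) ?A" if "j \<in> J" for j
      using mqz_has_sum[of "us @ p j # vs"] assms(2)[OF that] by simp
  qed
  ultimately have "(mqz_summand (us @ ?f # vs) has_sum (\<Sum>j\<in>J. fps_const (c j) * mqz (us @ p j # vs))) ?A"
    by presburger
  then show ?thesis by (simp add: mqz_def infsumI)
qed

text \<open>Lowering every entry by 1 keeps a tuple positive when its last entry exceeds 1; a last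
  entry 1 drops out and leaves a shorter tuple.\<close>

lemma decreasing_tuples_Suc:
  "decreasing_tuples (Suc k) =
     map Suc ` decreasing_tuples (Suc k) \<union> (\<lambda>ns. map Suc ns @ [1]) ` decreasing_tuples k"
  (is "_ = ?A \<union> ?B")
proof
  show "?A \<union> ?B \<subseteq> decreasing_tuples (Suc k)"
    by (auto simp: decreasing_tuples_def sorted_wrt_append sorted_wrt_map)
  show "decreasing_tuples (Suc k) \<subseteq> ?A \<union> ?B"
  proof
    fix ns assume ns: "ns \<in> decreasing_tuples (Suc k)"
    then obtain ms m where msm: "ns = ms @ [m]" by (cases ns rule: rev_cases) (auto simp: decreasing_tuples_def)
    have ms: "length ms = k" "sorted_wrt (>) ms" "\<forall>n\<in>set ms. m < n" "0 < m"
      using ns by (auto simp: msm decreasing_tuples_def sorted_wrt_append)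
    have Suc_pred: "map Suc (map (\<lambda>n. n - 1) xs) = xs" if "\<forall>n\<in>set xs. 0 < n" for xs
      using that by (induction xs) auto
    have sorted_pred: "sorted_wrt (>) (map (\<lambda>n. n - 1) xs)" if "\<forall>n\<in>set xs. 0 < n" "sorted_wrt (>) xs" for xs :: "nat list"
      using that by (induction xs) (auto simp: diff_less_mono)
    show "ns \<in> ?A \<union> ?B"
    proof (cases "m = 1")
      case True
      have "map (\<lambda>n. n - 1) ms \<in> decreasing_tuples k"
        using ms True sorted_pred[of ms] by (fastforce simp: decreasing_tuples_def)
      moreover have "ns = map Suc (map (\<lambda>n. n - 1) ms) @ [1]"
        using ms by (subst Suc_pred) (auto simp: msm True)
      ultimately show ?thesis by blast
    next
      case False
      have "\<forall>n\<in>set ns. 1 < n" using ms False by (auto simp: msm)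
      then have "map (\<lambda>n. n - 1) ns \<in> decreasing_tuples (Suc k)"
        using ns sorted_pred[of ns] by (auto simp: decreasing_tuples_def)
      moreover have "ns = map Suc (map (\<lambda>n. n - 1) ns)"
        using ns by (subst Suc_pred) (auto simp: decreasing_tuples_def)
      ultimately show ?thesis by blast
    qed
  qed
qed

lemma mqz_summand_mon:
  "mqz_summand (map (monom 1) s) ns = fps_X ^ (\<Sum>i<length s. s ! i * ns ! i)"
proof -
  have *: "monom 1 a \<circ>\<^sub>p monom 1 n = (monom 1 (a * n) :: rat poly)" for a n
    by (induction a) (simp_all add: monom_Suc pcompose_pCons mult_monom add_ac pcompose_1)
  then show ?thesis
    by (simp add: mqz_summand_def * fps_of_poly_monom' power_sum)
qed

lemma mqz_summand_mon_shift:
  assumes "length ns = length s"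
  shows "mqz_summand (map (monom 1) s) (map Suc ns) =
    fps_X ^ sum_list s * mqz_summand (map (monom 1) s) ns"
proof -
  have "(\<Sum>i<length s. s ! i * map Suc ns ! i) = (\<Sum>i<length s. s ! i) + (\<Sum>i<length s. s ! i * ns ! i)"
    unfolding sum.distrib[symmetric] using assms by (intro sum.cong) auto
  also have "(\<Sum>i<length s. s ! i) = sum_list s" by (simp add: sum_list_sum_nth atLeast0LessThan)
  finally show ?thesis by (simp add: mqz_summand_mon power_add)
qed

lemma mqz_summand_mon_shift_snoc:
  assumes "length ns = length s"
  shows "mqz_summand (map (monom 1) (s @ [a])) (map Suc ns @ [1]) =
    fps_X ^ sum_list (s @ [a]) * mqz_summand (map (monom 1) s) ns"
proof -
  have "mqz_summand (map (monom 1) (s @ [a])) (map Suc ns @ [1]) =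
      fps_X ^ a * mqz_summand (map (monom 1) s) (map Suc ns)"
    unfolding mqz_summand_mon using assms by (simp add: power_add nth_append mult.commute)
  then show ?thesis by (simp add: mqz_summand_mon_shift[OF assms] power_add mult_ac)
qed

lemma monom_in_poly_plus: "1 \<le> a \<Longrightarrow> monom 1 a \<in> poly_plus"
  unfolding poly_plus_def by (rule range_eqI[of _ _ "monom 1 (a - 1)"]) (simp add: mult_monom)

lemma mqz_mon_Nil [simp]: "mqz_mon [] = 1"
proof -
  have "decreasing_tuples 0 = {[]}" by (auto simp: decreasing_tuples_def)
  then show ?thesis by (simp add: mqz_mon_def mqz_def mqz_summand_def)
qed

lemma mqz_mon_has_sum:
  assumes "s \<noteq> [] \<Longrightarrow> 1 \<le> hd s"
  shows "(mqz_summand (map (monom 1) s) has_sum mqz_mon s) (decreasing_tuples (length s))"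
  using mqz_has_sum[of "map (monom 1) s"] assms monom_in_poly_plus
  by (cases s) (simp_all add: mqz_mon_def)

text \<open>With x = q^m for the total exponent m, raising all entries by 1 multiplies a summand by
  x. The two kinds of tuples therefore contribute x Z(s, a) and x Z(s), and the first contribution
  is moved to the left side.\<close>

lemma mqz_mon_snoc:
  assumes "1 \<le> hd (s @ [a])"
  shows "mqz_mon (s @ [a]) * (1 - fps_X ^ sum_list (s @ [a])) = fps_X ^ sum_list (s @ [a]) * mqz_mon s"
proof -
  let ?F = "mqz_summand (map (monom 1) (s @ [a]))" and ?x = "fps_X ^ sum_list (s @ [a]) :: rat fps"
  let ?A = "decreasing_tuples (Suc (length s))" and ?B = "decreasing_tuples (length s)"
  have A: "(?F has_sum mqz_mon (s @ [a])) ?A" using mqz_mon_has_sum[of "s @ [a]"] assms by simp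
  have "s \<noteq> [] \<Longrightarrow> 1 \<le> hd s" using assms by simp
  then have B: "(mqz_summand (map (monom 1) s) has_sum mqz_mon s) ?B" by (rule mqz_mon_has_sum)
  have "(?F has_sum ?x * mqz_mon (s @ [a])) (map Suc ` ?A)"
  proof (subst has_sum_reindex)
    have "((\<lambda>ns. ?x * ?F ns) has_sum ?x * mqz_mon (s @ [a])) ?A" using A by (rule has_sum_fps_cmult)
    also have "?this \<longleftrightarrow> ((?F \<circ> map Suc) has_sum ?x * mqz_mon (s @ [a])) ?A"
      by (intro has_sum_cong) (simp add: decreasing_tuples_def mqz_summand_mon_shift del: map_append)
    finally show "((?F \<circ> map Suc) has_sum ?x * mqz_mon (s @ [a])) ?A" .
  qed (simp add: inj_on_def)
  moreover have "(?F has_sum ?x * mqz_mon s) ((\<lambda>ns. map Suc ns @ [1]) ` ?B)"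
  proof (subst has_sum_reindex)
    have "((\<lambda>ns. ?x * mqz_summand (map (monom 1) s) ns) has_sum ?x * mqz_mon s) ?B"
      using B by (rule has_sum_fps_cmult)
    also have "?this \<longleftrightarrow> ((?F \<circ> (\<lambda>ns. map Suc ns @ [1])) has_sum ?x * mqz_mon s) ?B"
      by (intro has_sum_cong) (simp only: decreasing_tuples_def mem_Collect_eq o_def mqz_summand_mon_shift_snoc)
    finally show "((?F \<circ> (\<lambda>ns. map Suc ns @ [1])) has_sum ?x * mqz_mon s) ?B" .
  qed (simp add: inj_on_def)
  moreover have "map Suc ` ?A \<inter> (\<lambda>ns. map Suc ns @ [1]) ` ?B = {}"
  proof -
    have "1 \<notin> set (map Suc ns)" if "ns \<in> ?A" for ns using that by (auto simp: decreasing_tuples_def)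
    moreover have "1 \<in> set (map Suc ns @ [1])" for ns by simp
    ultimately show ?thesis by (metis (no_types, lifting) disjoint_iff imageE)
  qed
  ultimately have "(?F has_sum ?x * mqz_mon (s @ [a]) + ?x * mqz_mon s)
      (map Suc ` ?A \<union> (\<lambda>ns. map Suc ns @ [1]) ` ?B)"
    by (rule has_sum_fps_Un_disjoint)
  then have "(?F has_sum ?x * mqz_mon (s @ [a]) + ?x * mqz_mon s) ?A"
    by (simp only: decreasing_tuples_Suc[symmetric])
  from infsumI[OF A] infsumI[OF this]
  have "mqz_mon (s @ [a]) = ?x * mqz_mon (s @ [a]) + ?x * mqz_mon s" by (rule trans[OF sym])
  then show ?thesis by (simp add: algebra_simps)
qed

section \<open>Positive exponents\<close>

text \<open>The q-Pochhammer symbol (q; q)_n.\<close>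

definition qpoch :: "nat \<Rightarrow> rat poly"
  where "qpoch n = (\<Prod>i\<in>{1..n}. 1 - monom 1 i)"

definition xq :: "nat \<Rightarrow> rat fps"
  where "xq k = fps_X ^ k / (1 - fps_X ^ k)"

lemma fps_of_poly_one_minus_monom: "fps_of_poly (1 - monom 1 k :: rat poly) = 1 - fps_X ^ k"
  by (simp add: fps_of_poly_diff fps_of_poly_monom')

lemma one_minus_fps_X_power_nz: "0 < k \<Longrightarrow> 1 - fps_X ^ k \<noteq> (0 :: rat fps)"
proof
  assume "0 < k" "1 - fps_X ^ k = (0 :: rat fps)"
  then have "fps_nth (1 - fps_X ^ k :: rat fps) 0 = 0" by (simp only: fps_zero_nth)
  then show False using \<open>0 < k\<close> by simp
qed

lemma xq_mult: "0 < k \<Longrightarrow> xq k * (1 - fps_X ^ k) = fps_X ^ k"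
  unfolding xq_def
  by (subst fps_divide_unit) (simp_all add: mult.assoc inverse_mult_eq_1)

lemma xq_ratfun: "0 < k \<Longrightarrow> xq k \<in> ratfun (1 - monom 1 k)"
  by (rule ratfunI[of "monom 1 k"])
    (simp_all only: xq_mult fps_of_poly_one_minus_monom degree_one_minus_monom degree_monom_eq
      fps_of_poly_monom' one_neq_zero not_False_eq_True order_refl)

text \<open>Iterated, this makes \<open>mqz_mon s\<close> the product of \<open>xq m\<close> over
  the partial sums m of s, the form from which denominators are read off. A positive first entry
  keeps every m positive.\<close>

lemma mqz_mon_snoc_xq:
  assumes "1 \<le> hd (s @ [a])"
  shows "mqz_mon (s @ [a]) = xq (sum_list (s @ [a])) * mqz_mon s"
proof -
  have pos: "0 < sum_list (s @ [a])" using assms by (cases s) auto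
  let ?x = "fps_X ^ sum_list (s @ [a]) :: rat fps"
  have nz: "1 - ?x \<noteq> 0" using pos by (rule one_minus_fps_X_power_nz)
  have "mqz_mon (s @ [a]) * (1 - ?x) = (xq (sum_list (s @ [a])) * (1 - ?x)) * mqz_mon s"
    by (simp only: mqz_mon_snoc[OF assms] xq_mult[OF pos])
  then have "mqz_mon (s @ [a]) * (1 - ?x) = (xq (sum_list (s @ [a])) * mqz_mon s) * (1 - ?x)"
    by (simp only: mult_ac)
  then show ?thesis using nz by (simp only: mult_cancel_right) blast
qed

lemma subspace_mult_left:
  assumes "fps_rat.subspace V"
  shows "fps_rat.subspace {f. c * f \<in> V}"
  by (rule fps_rat.subspaceI)
    (use assms in \<open>auto simp: distrib_left mult.left_commute[of c] fps_rat.subspace_0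
      fps_rat.subspace_add fps_rat.subspace_scale\<close>)

lemma span_mult_left:
  assumes "f \<in> fps_rat.span S" "\<And>g. g \<in> S \<Longrightarrow> c * g \<in> V" "fps_rat.subspace V"
  shows "c * f \<in> V"
  using fps_rat.span_minimal[of S "{f. c * f \<in> V}"] subspace_mult_left[OF assms(3), of c] assms(1,2)
  by blast

lemma qpoch_0 [simp]: "qpoch 0 = 1"
  by (simp add: qpoch_def)

lemma qpoch_Suc: "qpoch (Suc n) = qpoch n * (1 - monom 1 (Suc n))"
  by (simp add: qpoch_def prod.nat_ivl_Suc')

lemma coeff_0_qpoch: "coeff (qpoch n) 0 \<noteq> 0"
  unfolding qpoch_def by (intro coeff_0_prod_nz) simp

lemma qpoch_nz: "qpoch n \<noteq> 0"
  by (metis coeff_0 coeff_0_qpoch)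

lemma degree_qpoch: "degree (qpoch n) = Suc n choose 2"
proof (induction n)
  case (Suc n)
  have "degree (qpoch (Suc n)) = degree (qpoch n) + Suc n"
    unfolding qpoch_Suc by (subst degree_mult_eq) (simp_all only: qpoch_nz one_minus_monom_nz degree_one_minus_monom zero_less_Suc not_False_eq_True)
  then show ?case by (simp add: Suc numeral_2_eq_2)
qed simp

lemma qpoch_mult_dvd:
  assumes "m < k" "k \<le> n" shows "qpoch m * (1 - monom 1 k) dvd qpoch n"
proof -
  have "qpoch m * (1 - monom 1 k) = (\<Prod>i\<in>insert k {1..m}. 1 - monom 1 i)"
    using assms by (subst prod.insert) (auto simp: qpoch_def)
  also have "\<dots> dvd qpoch n"
    unfolding qpoch_def using assms by (intro prod_dvd_prod_subset) auto
  finally show ?thesis .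
qed

lemma qpoch_dvd: "m \<le> n \<Longrightarrow> qpoch m dvd qpoch n"
  unfolding qpoch_def by (intro prod_dvd_prod_subset) auto

text \<open>Positive entries make the partial sums strictly increasing, so the factors 1 - q^m in
  the denominator are distinct factors of \<open>qpoch\<close>.\<close>

lemma mqz_mon_in_ratfun_qpoch:
  assumes "\<forall>i\<in>set s. 1 \<le> i" "sum_list s \<le> n"
  shows "mqz_mon s \<in> ratfun (qpoch n)"
proof -
  have "mqz_mon s \<in> ratfun (qpoch (sum_list s))"
    using assms(1)
  proof (induction s rule: rev_induct)
    case Nil
    then show ?case by (simp add: ratfun_1 fps_rat.span_base)
  next
    case (snoc a s)
    let ?m = "sum_list (s @ [a])"
    have a: "1 \<le> a" "1 \<le> hd (s @ [a])" using snoc.prems by (cases s; simp)+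
    have "mqz_mon s * xq ?m \<in> ratfun (qpoch (sum_list s) * (1 - monom 1 ?m))"
      using snoc a by (intro ratfun_mult xq_ratfun qpoch_nz one_minus_monom_nz) auto
    also have "\<dots> \<subseteq> ratfun (qpoch ?m)"
      using a by (intro ratfun_mono qpoch_mult_dvd qpoch_nz) auto
    finally show ?case by (simp only: mqz_mon_snoc_xq[OF a(2)] mult.commute)
  qed
  also have "\<dots> \<subseteq> ratfun (qpoch n)" using assms(2) by (intro ratfun_mono qpoch_dvd qpoch_nz)
  finally show ?thesis .
qed

section \<open>Words in 1 and 2 and the basis fractions over \<open>qpoch\<close>\<close>

definition yq :: "nat \<Rightarrow> nat \<Rightarrow> rat fps"
  where "yq n i = fps_X ^ i * inverse (fps_of_poly (qpoch n))"

lemma yq_mult: "yq n i * fps_of_poly (qpoch n) = fps_X ^ i"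
  by (simp only: yq_def mult.assoc fps_inverse_mult_cancel[OF coeff_0_qpoch] mult_1_right)

lemma yq_Suc: "yq n i = yq (Suc n) i * (1 - fps_X ^ Suc n)"
proof -
  have "yq n i * fps_of_poly (qpoch n) = (yq (Suc n) i * (1 - fps_X ^ Suc n)) * fps_of_poly (qpoch n)"
    using yq_mult[of "Suc n" i] unfolding yq_mult[of n]
    by (simp only: qpoch_Suc fps_of_poly_mult fps_of_poly_one_minus_monom mult_ac)
  then show ?thesis using qpoch_nz by (metis fps_of_poly_0 fps_of_poly_eq_iff mult_cancel_right)
qed

text \<open>Expanding by the factor 1 - q^(n+1) is one way from level n to level n + 1;
  multiplication by \<open>xq (Suc n)\<close>, which shifts the exponent, is the other. The
  inductions below combine the two.\<close>

lemma yq_diff: "yq n i = yq (Suc n) i - yq (Suc n) (Suc n + i)"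
  unfolding yq_Suc[of n] right_diff_distrib mult_1_right by (simp only: yq_def power_add mult_ac)

lemma xq_mult_yq: "xq (Suc n) * yq n i = yq (Suc n) (Suc n + i)"
proof -
  have "xq (Suc n) * yq n i = yq (Suc n) i * (xq (Suc n) * (1 - fps_X ^ Suc n))"
    unfolding yq_Suc[of n] by (simp only: mult_ac)
  also have "\<dots> = yq (Suc n) (Suc n + i)"
    unfolding xq_mult[OF zero_less_Suc] by (simp only: yq_def power_add mult_ac)
  finally show ?thesis .
qed

text \<open>The exact weight n is recorded because appending a letter a multiplies by
  \<open>xq (n + a)\<close>.\<close>

definition mqz12_eq :: "nat \<Rightarrow> rat fps set"
  where "mqz12_eq n = fps_rat.span {mqz_mon s |s. set s \<subseteq> {1, 2} \<and> sum_list s = n}"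

definition mqz12_le :: "nat \<Rightarrow> rat fps set"
  where "mqz12_le n = fps_rat.span {mqz_mon s |s. set s \<subseteq> {1, 2} \<and> sum_list s \<le> n}"

lemma one_in_mqz12_eq_0: "1 \<in> mqz12_eq 0"
  unfolding mqz12_eq_def by (intro fps_rat.span_base CollectI exI[of _ "[]"]) simp

lemma mqz12_eq_step:
  assumes "f \<in> mqz12_eq n" "a \<in> {1, 2}"
  shows "xq (n + a) * f \<in> mqz12_eq (n + a)"
  using assms(1) unfolding mqz12_eq_def
proof (rule span_mult_left)
  fix g assume "g \<in> {mqz_mon s |s. set s \<subseteq> {1, 2} \<and> sum_list s = n}"
  then obtain s where s: "g = mqz_mon s" "set s \<subseteq> {1, 2}" "sum_list s = n" by blast
  have "1 \<le> hd (s @ [a])" using s assms(2) by (cases s) auto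
  then have "xq (n + a) * g = mqz_mon (s @ [a])" by (simp add: mqz_mon_snoc_xq s)
  moreover have "set (s @ [a]) \<subseteq> {1, 2}" "sum_list (s @ [a]) = n + a" using s assms(2) by auto
  ultimately show "xq (n + a) * g \<in> fps_rat.span {mqz_mon s |s. set s \<subseteq> {1, 2} \<and> sum_list s = n + a}"
    by (intro fps_rat.span_base CollectI exI[of _ "s @ [a]"]) simp
qed (rule fps_rat.subspace_span)

text \<open>
  The exponents in this window already suffice: multiplication by \<open>xq (Suc n)\<close> moves the window for
  \<open>n\<close> onto all of the next one except its left end, which comes from \<open>xq (n + 2)\<close> applied to the
  right end of the window for \<open>n\<close>.
\<close>
lemma yq_in_mqz12_eq:
  "(n - 1) choose 2 \<le> i \<Longrightarrow> i \<le> n choose 2 \<Longrightarrow> yq n (n + i) \<in> mqz12_eq n"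
proof (induction n arbitrary: i rule: induct_nat_012)
  case 0
  show ?case using 0 one_in_mqz12_eq_0 by (simp add: yq_def numeral_2_eq_2)
next
  case 1
  have "yq 0 0 \<in> mqz12_eq 0" using one_in_mqz12_eq_0 by (simp add: yq_def)
  from mqz12_eq_step[OF this, of 1] show ?case using 1 xq_mult_yq[of 0 0] by (simp add: numeral_2_eq_2)
next
  case (ge2 n)
  let ?m = "Suc (Suc n)"
  have c: "?m choose 2 = (Suc n choose 2) + Suc n" "Suc n choose 2 = (n choose 2) + n"
    by (simp_all add: numeral_2_eq_2)
  \<comment> \<open>Away from the left end, i - (n + 1) lies in the window of level n + 1, and
    appending the letter 1 shifts it to i.\<close>
  have *: "yq ?m (?m + i) \<in> mqz12_eq ?m" if i: "Suc n choose 2 < i" "i \<le> ?m choose 2" for i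
  proof -
    have "Suc n \<le> i" using i(1) c(2) by linarith
    then obtain j where j: "i = Suc n + j" by (rule le_Suc_ex[THEN exE])
    have "n choose 2 \<le> j" "j \<le> Suc n choose 2" using i c j by linarith+
    then have "yq (Suc n) (Suc n + j) \<in> mqz12_eq (Suc n)"
      by (intro ge2.IH(2)) (simp_all only: diff_Suc_1)
    from mqz12_eq_step[OF this, of 1] show ?thesis by (simp add: xq_mult_yq j)
  qed
  show ?case
  proof (cases "i = Suc n choose 2")
    case True
    let ?j = "n choose 2"
    have "(n - 1) choose 2 \<le> ?j" by (cases n) (simp_all add: numeral_2_eq_2)
    then have "yq n (n + ?j) \<in> mqz12_eq n" by (intro ge2.IH(1) order_refl)
    moreover have i: "n + ?j = i" using True c(2) by linarith
    ultimately have "xq (n + 2) * yq n i \<in> mqz12_eq (n + 2)"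
      using mqz12_eq_step[of "yq n i" n 2] by simp
    \<comment> \<open>Going through level n + 1 by \<open>yq_diff\<close>, the letter 2 yields the
      wanted element minus the right end of the new window, which \<open>*\<close> already
      covers.\<close>
    then have "yq ?m (?m + i) - yq ?m (?m + (Suc n + i)) \<in> mqz12_eq ?m"
      unfolding yq_diff[of n i] right_diff_distrib add_2_eq_Suc' xq_mult_yq .
    moreover have "yq ?m (?m + (Suc n + i)) \<in> mqz12_eq ?m"
      by (rule *) (use True c(1) in linarith)+
    ultimately show ?thesis
      using fps_rat.span_add[of "yq ?m (?m + i) - yq ?m (?m + (Suc n + i))" _ "yq ?m (?m + (Suc n + i))"]
      unfolding mqz12_eq_def by simp
  next
    case False
    then show ?thesis using ge2.prems by (intro *) auto
  qed
qed

lemma mqz12_eq_subset_le: "m \<le> n \<Longrightarrow> mqz12_eq m \<subseteq> mqz12_le n"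
  unfolding mqz12_eq_def mqz12_le_def by (intro fps_rat.span_mono) auto

lemma mqz12_le_mono: "m \<le> n \<Longrightarrow> mqz12_le m \<subseteq> mqz12_le n"
  unfolding mqz12_le_def by (intro fps_rat.span_mono) auto

text \<open>Induction on the level and, within it, downwards on the exponent. Large exponents lie in
  the window of \<open>yq_in_mqz12_eq\<close>; below it, \<open>yq_diff\<close> writes the element
  as one of the previous level plus one of larger exponent.\<close>

lemma yq_in_mqz12_le: "i \<le> Suc n choose 2 \<Longrightarrow> yq n i \<in> mqz12_le n"
proof (induction n arbitrary: i)
  case 0
  then show ?case using yq_in_mqz12_eq[of 0 i] mqz12_eq_subset_le[of 0 0] by (auto simp: numeral_2_eq_2)
next
  case (Suc n)
  let ?m = "Suc n"
  have c: "Suc ?m choose 2 = (?m choose 2) + ?m" "?m choose 2 = (n choose 2) + n"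
    by (simp_all add: numeral_2_eq_2)
  show ?case
    using Suc.prems
  proof (induction "(Suc ?m choose 2) - i" arbitrary: i rule: less_induct)
    case less
    show ?case
    proof (cases "?m + (n choose 2) \<le> i")
      case True
      then obtain j where j: "i = ?m + j" "n choose 2 \<le> j" 
        using le_Suc_ex[OF True] by (metis add.assoc le_add1)
      then have "yq ?m (?m + j) \<in> mqz12_eq ?m" using less.prems c by (intro yq_in_mqz12_eq) auto
      then show ?thesis using mqz12_eq_subset_le[of ?m ?m] j by auto
    next
      case False
      then have i: "i \<le> ?m choose 2" using c by simp
      then have "yq n i \<in> mqz12_le ?m" using Suc.IH mqz12_le_mono[of n ?m] by auto
      moreover have "yq ?m (?m + i) \<in> mqz12_le ?m" using i c by (intro less.hyps) auto
      moreover have "yq ?m i = yq n i + yq ?m (?m + i)" by (simp only: yq_diff[of n i] diff_add_cancel)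
      ultimately show ?thesis unfolding mqz12_le_def by (simp add: fps_rat.span_add)
    qed
  qed
qed

text \<open>Together with \<open>mqz_mon_in_ratfun_qpoch\<close> this shows that words with larger
  positive entries add nothing to the words in 1 and 2 of the same weight bound.\<close>

lemma ratfun_qpoch: "ratfun (qpoch n) = mqz12_le n"
proof
  have "yq n ` {..degree (qpoch n)} \<subseteq> mqz12_le n"
    using yq_in_mqz12_le by (auto simp: degree_qpoch)
  then show "ratfun (qpoch n) \<subseteq> mqz12_le n"
    unfolding ratfun_basis(1)[OF coeff_0_qpoch] yq_def[symmetric] mqz12_le_def
    by (rule fps_rat.span_minimal) (rule fps_rat.subspace_span)
  show "mqz12_le n \<subseteq> ratfun (qpoch n)"
    unfolding mqz12_le_def
    by (rule fps_rat.span_minimal) (auto intro!: mqz_mon_in_ratfun_qpoch subspace_ratfun)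
qed

section \<open>Nonnegative exponents\<close>

text \<open>A least common multiple of the polynomials 1 - q^m for 1 \<le> m \<le> n.\<close>

definition cyc_prod :: "nat \<Rightarrow> rat poly"
  where "cyc_prod n = (\<Prod>d\<in>{1..n}. cyc d)"

definition cyc_tower :: "nat \<Rightarrow> rat poly"
  where "cyc_tower n = (\<Prod>r\<in>{1..n}. cyc_prod r)"

lemma fps_of_poly_eq_0_iff: "fps_of_poly p = 0 \<longleftrightarrow> p = 0"
  by (metis fps_of_poly_0 fps_of_poly_eq_iff)

lemma cyc_prod_Suc: "cyc_prod (Suc n) = cyc_prod n * cyc (Suc n)"
  by (simp add: cyc_prod_def prod.nat_ivl_Suc')

lemma cyc_tower_0 [simp]: "cyc_tower 0 = 1"
  by (simp add: cyc_tower_def)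

lemma cyc_tower_Suc: "cyc_tower (Suc n) = cyc_tower n * cyc_prod (Suc n)"
  by (simp add: cyc_tower_def prod.nat_ivl_Suc')

lemma coeff_0_cyc_prod: "coeff (cyc_prod n) 0 \<noteq> 0"
  unfolding cyc_prod_def by (intro coeff_0_prod_nz coeff_0_cyc) auto

lemma coeff_0_cyc_tower: "coeff (cyc_tower n) 0 \<noteq> 0"
  unfolding cyc_tower_def by (intro coeff_0_prod_nz coeff_0_cyc_prod)

lemma cyc_prod_nz: "cyc_prod n \<noteq> 0"
  by (metis coeff_0 coeff_0_cyc_prod)

lemma cyc_tower_nz: "cyc_tower n \<noteq> 0"
  by (metis coeff_0 coeff_0_cyc_tower)

lemma degree_cyc_prod: "degree (cyc_prod n) = (\<Sum>d\<in>{1..n}. totient d)"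
  unfolding cyc_prod_def
  by (subst degree_prod_eq_sum_degree) (auto simp: cyc_nz degree_cyc)

lemma degree_cyc_tower: "degree (cyc_tower n) = (\<Sum>r\<in>{1..n}. \<Sum>d\<in>{1..r}. totient d)"
  unfolding cyc_tower_def
  by (subst degree_prod_eq_sum_degree) (auto simp: cyc_prod_nz degree_cyc_prod)

lemma cyc_prod_dvd: "m \<le> n \<Longrightarrow> cyc_prod m dvd cyc_prod n"
  unfolding cyc_prod_def by (intro prod_dvd_prod_subset) auto

lemma cyc_tower_dvd: "m \<le> n \<Longrightarrow> cyc_tower m dvd cyc_tower n"
  unfolding cyc_tower_def by (intro prod_dvd_prod_subset) auto

lemma one_minus_monom_dvd_cyc_prod:
  assumes "0 < m" "m \<le> n" shows "1 - monom 1 m dvd cyc_prod n"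
proof -
  have "{d. d dvd m} \<subseteq> {1..n}"
  proof
    fix d assume "d \<in> {d. d dvd m}"
    then show "d \<in> {1..n}"
      using assms dvd_imp_le[of d m] dvd_pos_nat[of m d] by simp
  qed
  then show ?thesis
    unfolding prod_cyc[OF assms(1), symmetric] cyc_prod_def by (intro prod_dvd_prod_subset) auto
qed

text \<open>As m < n, \<open>cyc_tower m\<close> leaves the last level \<open>cyc_prod n\<close>
  free, and that level absorbs 1 - q^k.\<close>

lemma cyc_tower_mult_dvd:
  assumes "0 < k" "k \<le> n" "m < n"
  shows "cyc_tower m * (1 - monom 1 k) dvd cyc_tower n"
proof -
  obtain l where l: "n = Suc l" "m \<le> l" using assms(3) by (cases n) auto
  show ?thesis
    unfolding l(1) cyc_tower_Suc
    using l assms by (intro mult_dvd_mono cyc_tower_dvd one_minus_monom_dvd_cyc_prod) auto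
qed

text \<open>A coarse bound for comparing the two algebras, where weights do not matter.\<close>

lemma cyc_tower_dvd_power: "cyc_tower n dvd cyc_prod n ^ n"
proof -
  have "cyc_tower n dvd (\<Prod>r\<in>{1..n}. cyc_prod n)"
    unfolding cyc_tower_def by (intro prod_dvd_prod cyc_prod_dvd) auto
  then show ?thesis by simp
qed

lemma qpoch_dvd_cyc_tower: "qpoch n dvd cyc_tower n"
  unfolding qpoch_def cyc_tower_def by (intro prod_dvd_prod one_minus_monom_dvd_cyc_prod) auto

lemma cyc_tower_eq: "cyc_tower n = (\<Prod>d\<in>{1..n}. cyc d ^ (Suc n - d))"
proof (induction n)
  case (Suc n)
  have "(\<Prod>d\<in>{1..n}. cyc d ^ (Suc (Suc n) - d)) = (\<Prod>d\<in>{1..n}. cyc d ^ (Suc n - d) * cyc d)"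
    by (intro prod.cong) (auto simp: Suc_diff_le)
  also have "\<dots> = cyc_tower n * cyc_prod n"
    unfolding prod.distrib Suc cyc_prod_def ..
  finally have "(\<Prod>d\<in>{1..n}. cyc d ^ (Suc (Suc n) - d)) = cyc_tower n * cyc_prod n" .
  then show ?case by (simp add: prod.nat_ivl_Suc' cyc_tower_Suc cyc_prod_Suc mult_ac)
qed simp

text \<open>Reduces membership questions to denominators that are powers of a single
  \<open>cyc d\<close>.\<close>

lemma ratfun_prod_cyc_subset:
  assumes "fps_rat.subspace V" "1 \<in> V"
    and "\<And>d. 0 < d \<Longrightarrow> d \<le> n \<Longrightarrow> ratfun (cyc d ^ k d) \<subseteq> V"
  shows "ratfun (\<Prod>d\<in>{1..n}. cyc d ^ k d) \<subseteq> V"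
proof (rule ratfun_prod_subset[OF assms(1,2)])
  fix d e assume "d \<in> {1..n}" "e \<in> {1..n}" "d \<noteq> e"
  then have "coprime (cyc d) (cyc e)" by (intro coprime_cyc) auto
  then show "coprime (cyc d ^ k d) (cyc e ^ k e)" by simp
next
  fix d assume "d \<in> {1..n}"
  then show "coeff (cyc d ^ k d) 0 \<noteq> 0" using coeff_0_cyc[of d] by (simp add: coeff_0_power)
qed (use assms(3) in auto)

text \<open>An entry 0 counts 1, because W_0 B = 0 and constants first occur in W_1 B.\<close>

definition mqz_wt :: "nat list \<Rightarrow> nat"
  where "mqz_wt s = sum_list (map (max 1) s)"

definition mqz_wt_le :: "nat \<Rightarrow> rat fps set"
  where "mqz_wt_le n = fps_rat.span {mqz_mon s |s. (s \<noteq> [] \<longrightarrow> 1 \<le> hd s) \<and> mqz_wt s \<le> n}"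

lemma sum_list_le_mqz_wt: "sum_list s \<le> mqz_wt s"
  by (induction s) (auto simp: mqz_wt_def)

text \<open>Every letter, 0 included, raises the weight, and the partial sum m never exceeds the
  weight reached. So each new factor 1 - q^m finds a level of the tower of its own.\<close>

lemma mqz_mon_in_ratfun_cyc_tower:
  assumes "s \<noteq> [] \<longrightarrow> 1 \<le> hd s" "mqz_wt s \<le> n"
  shows "mqz_mon s \<in> ratfun (cyc_tower n)"
proof -
  have "mqz_mon s \<in> ratfun (cyc_tower (mqz_wt s))"
    using assms(1)
  proof (induction s rule: rev_induct)
    case Nil
    then show ?case by (simp add: mqz_wt_def ratfun_1 fps_rat.span_base)
  next
    case (snoc a s)
    let ?m = "sum_list (s @ [a])"
    have hd: "1 \<le> hd (s @ [a])" using snoc.prems by simp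
    have pos: "0 < ?m" using hd by (cases s) auto
    have le: "?m \<le> mqz_wt (s @ [a])" by (rule sum_list_le_mqz_wt)
    have lt: "mqz_wt s < mqz_wt (s @ [a])" by (simp add: mqz_wt_def)
    have "s \<noteq> [] \<longrightarrow> 1 \<le> hd s" using hd by auto
    then have "mqz_mon s * xq ?m \<in> ratfun (cyc_tower (mqz_wt s) * (1 - monom 1 ?m))"
      by (intro ratfun_mult xq_ratfun[OF pos] cyc_tower_nz one_minus_monom_nz[OF pos] snoc.IH)
    also have "\<dots> \<subseteq> ratfun (cyc_tower (mqz_wt (s @ [a])))"
      by (intro ratfun_mono cyc_tower_mult_dvd[OF pos le lt] cyc_tower_nz)
    finally show ?case by (simp only: mqz_mon_snoc_xq[OF hd] mult.commute)
  qed
  also have "\<dots> \<subseteq> ratfun (cyc_tower n)"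
    using assms(2) by (intro ratfun_mono cyc_tower_dvd cyc_tower_nz)
  finally show ?thesis .
qed

section \<open>Spanning by words with zeros\<close>

lemma subspace_mqz_wt_le: "fps_rat.subspace (mqz_wt_le n)"
  unfolding mqz_wt_le_def by (rule fps_rat.subspace_span)

lemma mqz_wt_le_mono: "m \<le> n \<Longrightarrow> mqz_wt_le m \<subseteq> mqz_wt_le n"
  unfolding mqz_wt_le_def by (intro fps_rat.span_mono) auto

text \<open>The letter \<open>m - sum_list s\<close> brings the partial sum to m; each 0 keeps it
  there and repeats the factor \<open>xq m\<close>.\<close>

lemma mqz_mon_replicate_0:
  assumes "\<forall>i\<in>set s. 1 \<le> i" "sum_list s < m"
  shows "mqz_mon (s @ (m - sum_list s) # replicate k 0) = xq m ^ Suc k * mqz_mon s"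
proof (induction k)
  case 0
  have "1 \<le> hd (s @ [m - sum_list s])" using assms by (cases s) auto
  then show ?case using assms by (simp add: mqz_mon_snoc_xq)
next
  case (Suc k)
  let ?t = "s @ (m - sum_list s) # replicate k 0"
  have "1 \<le> hd (?t @ [0])" using assms by (cases s) auto
  then have "mqz_mon (?t @ [0]) = xq (sum_list (?t @ [0])) * mqz_mon ?t" by (rule mqz_mon_snoc_xq)
  also have "sum_list (?t @ [0]) = m" using assms(2) by (simp add: sum_list_replicate)
  finally have "mqz_mon (?t @ [0]) = xq m ^ Suc (Suc k) * mqz_mon s" unfolding Suc by (simp only: power_Suc mult.assoc)
  moreover have "s @ (m - sum_list s) # replicate (Suc k) 0 = ?t @ [0]"
    by (simp add: replicate_append_same)
  ultimately show ?case by (simp only:)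
qed

text \<open>By \<open>ratfun_qpoch\<close> f may be taken to be a word in 1 and 2 of sum at most n.
  It is filled up to sum n + 1 and followed by j - 1 zeros, of total weight n + j. This supplies
  poles of order j at the roots of \<open>cyc (Suc n)\<close>.\<close>

lemma xq_power_mult_in_mqz_wt_le:
  assumes "f \<in> ratfun (qpoch n)" "0 < j"
  shows "xq (Suc n) ^ j * f \<in> mqz_wt_le (n + j)"
proof -
  obtain k where k: "j = Suc k" using assms(2) by (cases j) auto
  show ?thesis
    using assms(1) unfolding ratfun_qpoch mqz12_le_def
  proof (rule span_mult_left[OF _ _ subspace_mqz_wt_le])
    fix g assume "g \<in> {mqz_mon s |s. set s \<subseteq> {1, 2} \<and> sum_list s \<le> n}"
    then obtain s where s: "g = mqz_mon s" "set s \<subseteq> {1, 2}" "sum_list s \<le> n" by blast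
    let ?t = "s @ (Suc n - sum_list s) # replicate k 0"
    have s1: "\<forall>i\<in>set s. 1 \<le> i" using s(2) by auto
    then have "map (max 1) s = s" by (induction s) auto
    then have wt: "mqz_wt ?t = n + j" using s(3) by (simp add: mqz_wt_def sum_list_replicate k)
    have "1 \<le> hd ?t" using s1 s(3) by (cases s) auto
    then have "mqz_mon ?t \<in> mqz_wt_le (n + j)"
      unfolding mqz_wt_le_def using wt by (intro fps_rat.span_base CollectI exI[of _ ?t]) simp
    then show "xq (Suc n) ^ j * g \<in> mqz_wt_le (n + j)"
      unfolding k s(1) using s1 s(3) by (subst mqz_mon_replicate_0[symmetric]) auto
  qed
qed

lemma one_in_mqz_wt_le: "1 \<in> mqz_wt_le n"
  unfolding mqz_wt_le_def
  by (intro fps_rat.span_base CollectI exI[of _ "[]"]) (simp add: mqz_wt_def)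

text \<open>Strong induction on n, then induction on j. From f over c^(j+1), c =
  \<open>cyc (Suc n)\<close>, one subtracts a g of the kind in
  \<open>xq_power_mult_in_mqz_wt_le\<close> with the same leading part at c. Partial fractions split
  the rest into a piece over c^j and a piece over cyclotomic polynomials of smaller index, both
  known by induction.\<close>

lemma ratfun_cyc_power_subset: "ratfun (cyc (Suc n) ^ j) \<subseteq> mqz_wt_le (n + j)"
proof (induction n arbitrary: j rule: less_induct)
  case (less n)
  let ?e = "Suc n" and ?c = "cyc (Suc n)"
  let ?q = "\<Prod>d | d dvd ?e \<and> d < ?e. cyc d"
  note V = subspace_mqz_wt_le one_in_mqz_wt_le
  have c0: "coeff ?c 0 \<noteq> 0" by (rule coeff_0_cyc) simp
  have cnz: "?c \<noteq> 0" by (rule cyc_nz) simp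
  have eq: "{d. d dvd ?e} = insert ?e {d. d dvd ?e \<and> d < ?e}"
    by (auto dest: dvd_imp_le simp: le_less)
  have "(\<Prod>d\<in>insert ?e {d. d dvd ?e \<and> d < ?e}. cyc d) = ?c * ?q"
    by (rule prod.insert) auto
  then have cq: "1 - monom 1 ?e = ?c * ?q"
    unfolding prod_cyc[OF zero_less_Suc, symmetric] eq by simp
  have "?q dvd cyc_prod n"
    unfolding cyc_prod_def
    by (intro prod_dvd_prod_subset) (auto simp: Suc_le_eq intro: dvd_pos_nat[of ?e])
  \<comment> \<open>In \<open>M j\<close> the exponent of \<open>cyc d\<close> is j + n + 1 - d;
    since (d - 1) + (j + n + 1 - d) = n + j, the induction hypothesis reaches exactly weight n +
    j.\<close>
  define M where "M j = cyc_prod n ^ j * cyc_tower n" for j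
  have M_eq: "M j = (\<Prod>d\<in>{1..n}. cyc d ^ (j + (Suc n - d)))" for j
    by (simp only: M_def cyc_tower_eq cyc_prod_def prod_power_distrib power_add prod.distrib)
  have ratfun_M: "ratfun (M j) \<subseteq> mqz_wt_le (n + j)" for j
    unfolding M_eq
  proof (rule ratfun_prod_cyc_subset[OF V])
    fix d assume d: "0 < d" "d \<le> n"
    then have "ratfun (cyc (Suc (d - 1)) ^ (j + (Suc n - d))) \<subseteq> mqz_wt_le ((d - 1) + (j + (Suc n - d)))"
      by (intro less.IH) auto
    then show "ratfun (cyc d ^ (j + (Suc n - d))) \<subseteq> mqz_wt_le (n + j)" using d by (simp add: add.commute)
  qed
  have coprime_M: "coprime (?c ^ i) (M j)" for i j
  proof -
    have "coprime ?c (\<Prod>d\<in>{1..n}. cyc d ^ (j + (Suc n - d)))"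
      by (intro prod_coprime_right coprime_power_right_iff[THEN iffD2] disjI1 coprime_cyc) auto
    then show ?thesis unfolding M_eq by simp
  qed
  show ?case
  proof (induction j)
    case 0
    then show ?case using V by (simp add: ratfun_1 fps_rat.span_minimal)
  next
    case (Suc j)
    let ?V = "mqz_wt_le (n + Suc j)"
    \<comment> \<open>H is the part prime to \<open>?c\<close> of (1 - q^e)^(j+1) (q; q)_n, the
      denominator of the g below, e being \<open>?e\<close>.\<close>
    define H where "H = ?q ^ Suc j * qpoch n"
    have HM: "H dvd M (Suc j)"
      unfolding H_def M_def by (intro mult_dvd_mono dvd_power_same qpoch_dvd_cyc_tower \<open>?q dvd _\<close>)
    have M0: "coeff (M (Suc j)) 0 \<noteq> 0"
      unfolding M_def using coeff_0_cyc_prod coeff_0_cyc_tower by (simp add: coeff_mult_0 coeff_0_power)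
    have Mnz: "M (Suc j) \<noteq> 0" using M0 by (metis coeff_0)
    have H0: "coeff H 0 \<noteq> 0" using HM M0 by (auto simp: coeff_mult_0)
    have Hnz: "H \<noteq> 0" using H0 by (metis coeff_0)
    have ratfun_H: "ratfun H \<subseteq> ?V" using ratfun_mono[OF HM Mnz] ratfun_M by blast
    have coprime_H: "coprime (?c ^ j) H" by (rule coprime_divisors[OF dvd_refl HM coprime_M])
    have cH: "?c ^ Suc j * H = (1 - monom 1 ?e) ^ Suc j * qpoch n"
      unfolding H_def cq power_mult_distrib by (simp only: mult_ac)
    show ?case
    proof
      fix f assume "f \<in> ratfun (?c ^ Suc j)"
      then obtain P where P: "degree P \<le> degree (?c ^ Suc j)" "f * fps_of_poly (?c ^ Suc j) = fps_of_poly P"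
        by (rule ratfunE)
      \<comment> \<open>As \<open>q\<^sup>e = 1\<close> modulo \<open>?c\<close>, the factor \<open>?X\<close> in the numerator of \<open>g\<close> does not affect the
         residue, so \<open>f - g\<close> has a smaller power of \<open>?c\<close> in its denominator.\<close>
      define Q where "Q = (P * H) mod ?c"
      let ?X = "monom 1 (?e * Suc j) :: rat poly"
      \<comment> \<open>Reduction modulo \<open>?c\<close> brings the degree below \<phi>(e) \<le> n
        + 1, and n \<le> n (n + 1) / 2, so Q is an admissible numerator over
        \<open>qpoch n\<close>.\<close>
      have Q: "degree Q \<le> degree (qpoch n)"
      proof -
        have "degree ?c = totient ?e" by (rule degree_cyc) simp
        then have "0 < degree ?c" "degree ?c \<le> ?e" by (simp_all add: totient_le)
        then have "degree Q \<le> n" using degree_mod_less[OF cnz, of "P * H"] unfolding Q_def by auto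
        also have "n \<le> degree (qpoch n)" unfolding degree_qpoch by (simp add: numeral_2_eq_2)
        finally show ?thesis .
      qed
      define g where "g = xq ?e ^ Suc j * (fps_of_poly Q * inverse (fps_of_poly (qpoch n)))"
      have gV: "g \<in> ?V"
        unfolding g_def by (intro xq_power_mult_in_mqz_wt_le ratfun_inverse coeff_0_qpoch Q) simp
      have "g * fps_of_poly (?c ^ Suc j * H) =
          (xq ?e * (1 - fps_X ^ ?e)) ^ Suc j *
          (fps_of_poly Q * (inverse (fps_of_poly (qpoch n)) * fps_of_poly (qpoch n)))"
        unfolding cH g_def fps_of_poly_mult fps_of_poly_power fps_of_poly_one_minus_monom power_mult_distrib
        by (simp only: mult_ac)
      also have "\<dots> = fps_of_poly (?X * Q)"
        unfolding xq_mult[OF zero_less_Suc] fps_inverse_mult_cancel[OF coeff_0_qpoch]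
        by (simp only: fps_of_poly_mult fps_of_poly_monom' power_mult mult_1_right)
      finally have g: "g * fps_of_poly (?c ^ Suc j * H) = fps_of_poly (?X * Q)" .
      have "?c dvd 1 - ?X"
        by (rule dvd_trans[OF cyc_dvd[OF zero_less_Suc] one_minus_monom_dvd[OF dvd_triv_left]])
      then have "?c dvd (P * H - Q) + (1 - ?X) * Q"
        unfolding Q_def by (intro dvd_add dvd_mult2 dvd_minus_mod)
      also have "(P * H - Q) + (1 - ?X) * Q = P * H - ?X * Q" by (simp only: left_diff_distrib mult_1_left diff_add_cancel add_diff_eq)
      finally obtain S where S: "P * H - ?X * Q = ?c * S" by (rule dvdE)
      have "fps_of_poly ?c * ((f - g) * fps_of_poly (?c ^ j * H)) =
          (f * fps_of_poly (?c ^ Suc j)) * fps_of_poly H - g * fps_of_poly (?c ^ Suc j * H)"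
        by (simp only: power_Suc fps_of_poly_mult left_diff_distrib right_diff_distrib mult_ac)
      also have "\<dots> = fps_of_poly P * fps_of_poly H - fps_of_poly (?X * Q)" by (simp only: P(2) g)
      also have "\<dots> = fps_of_poly (P * H - ?X * Q)" by (simp only: fps_of_poly_diff fps_of_poly_mult)
      also have "\<dots> = fps_of_poly ?c * fps_of_poly S" by (simp only: S fps_of_poly_mult)
      finally have fg: "(f - g) * fps_of_poly (?c ^ j * H) = fps_of_poly S"
        using cnz by (simp only: mult_cancel_left fps_of_poly_eq_0_iff) blast
      \<comment> \<open>Regularity of f - g at infinity: in c S = P H - X Q both terms have degree
        at most that of c^(j+1) H, and one factor c cancels.\<close>
      have "degree S \<le> degree (?c ^ j * H)"
      proof -
        have "degree (?X * Q) \<le> degree ((1 - monom 1 ?e) ^ Suc j * qpoch n)"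
        proof -
          have "degree ((1 - monom 1 ?e :: rat poly) ^ Suc j * qpoch n) = ?e * Suc j + degree (qpoch n)"
            using one_minus_monom_nz[of ?e] qpoch_nz[of n]
            by (subst degree_mult_eq) (simp_all only: degree_power_eq degree_one_minus_monom power_eq_0_iff mult.commute not_False_eq_True zero_less_Suc simp_thms)
          moreover have "degree (?X * Q) \<le> ?e * Suc j + degree Q"
            by (rule order_trans[OF degree_mult_le]) (simp only: degree_monom_eq one_neq_zero not_False_eq_True order_refl)
          ultimately show ?thesis using Q by linarith
        qed
        moreover have "degree (P * H) \<le> degree (?c ^ Suc j * H)"
        proof -
          have "degree (?c ^ Suc j * H) = degree (?c ^ Suc j) + degree H"
            using cnz Hnz by (intro degree_mult_eq) (simp_all only: power_not_zero not_False_eq_True)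
          then show ?thesis using P(1) degree_mult_le[of P H] by linarith
        qed
        ultimately have "degree (?c * S) \<le> degree (?c ^ Suc j * H)"
          unfolding S[symmetric] cH by (intro degree_diff_le)
        moreover have "degree (?c ^ Suc j * H) = degree ?c + degree (?c ^ j * H)"
          unfolding power_Suc mult.assoc using cnz Hnz by (intro degree_mult_eq) simp_all
        ultimately show ?thesis using cnz by (cases "S = 0") (simp_all add: degree_mult_eq)
      qed
      then have "f - g \<in> ratfun (?c ^ j * H)" using fg by (rule ratfunI)
      then obtain a b where ab: "a \<in> ratfun (?c ^ j)" "b \<in> ratfun H" "f - g = a + b"
        using ratfun_mult_coprime[OF coprime_H _ H0, of "f - g"] c0 by (auto simp: coeff_0_power)
      have "a \<in> ?V" using ab(1) Suc.IH mqz_wt_le_mono[of "n + j" "n + Suc j"] by auto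
      moreover have "b \<in> ?V" using ab(2) ratfun_H by blast
      moreover have "f = a + b + g" using ab(3) by (simp add: algebra_simps)
      ultimately show "f \<in> ?V" using gV fps_rat.subspace_add[OF subspace_mqz_wt_le] by blast
    qed
  qed
qed

text \<open>The exponents of the tower fit the weight: \<open>cyc d\<close> to the power n + 1 - d
  needs weight (d - 1) + (n + 1 - d) = n.\<close>

lemma ratfun_cyc_tower: "ratfun (cyc_tower n) = mqz_wt_le n"
proof
  show "ratfun (cyc_tower n) \<subseteq> mqz_wt_le n"
    unfolding cyc_tower_eq
  proof (rule ratfun_prod_cyc_subset[OF subspace_mqz_wt_le one_in_mqz_wt_le])
    fix d assume "0 < d" "d \<le> n"
    then show "ratfun (cyc d ^ (Suc n - d)) \<subseteq> mqz_wt_le n"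
      using ratfun_cyc_power_subset[of "d - 1" "Suc n - d"] by simp
  qed
  show "mqz_wt_le n \<subseteq> ratfun (cyc_tower n)"
    unfolding mqz_wt_le_def
    by (rule fps_rat.span_minimal) (auto intro!: mqz_mon_in_ratfun_cyc_tower subspace_ratfun)
qed

section \<open>Weight filtrations and Poincare series\<close>

lemma coeff_0_poly_plus: "f \<in> poly_plus \<Longrightarrow> coeff f 0 = 0"
  unfolding poly_plus_def by (auto simp: coeff_mult_0)

text \<open>The slots are expanded into monomials one at a time, \<open>ss\<close> being the
  exponents already chosen. Only exponents with nonzero coefficient occur, so weight bounds pass on
  to the words. The appended \<open>monom 1 1\<close> keeps \<open>hd\<close> meaningful for an
  empty tensor.\<close>

lemma mqz_in_subspaceI:
  assumes V: "fps_rat.subspace V"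
  shows "hd (map (monom 1) ss @ gs @ [monom 1 1]) \<in> poly_plus \<Longrightarrow>
    (\<And>ts. list_all2 (\<lambda>t g. t \<le> degree g \<and> coeff g t \<noteq> 0) ts gs \<Longrightarrow> mqz_mon (ss @ ts) \<in> V) \<Longrightarrow>
    mqz (map (monom 1) ss @ gs) \<in> V"
proof (induction gs arbitrary: ss)
  case Nil
  then show ?case using Nil.prems(2)[of "[]"] by (simp add: mqz_mon_def)
next
  case (Cons g gs)
  define J where "J = {j. j \<le> degree g \<and> coeff g j \<noteq> 0}"
  have fin: "finite J" by (simp add: J_def)
  have "g = (\<Sum>j\<le>degree g. monom (coeff g j) j)" by (rule poly_as_sum_of_monoms[symmetric])
  also have "\<dots> = (\<Sum>j\<in>J. smult (coeff g j) (monom 1 j))"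
    unfolding J_def by (rule sum.mono_neutral_cong_right) (auto simp: smult_monom)
  finally have g: "g = (\<Sum>j\<in>J. smult (coeff g j) (monom 1 j))" .
  \<comment> \<open>In the first slot g has no constant term, so each j that occurs is positive and
    the expanded series converge.\<close>
  have hd: "hd (map (monom 1) ss @ monom 1 j # vs) \<in> poly_plus" if "j \<in> J" for j vs
  proof (cases ss)
    case Nil
    then have "g \<in> poly_plus" using Cons.prems(1) by simp
    then have "coeff g 0 = 0" by (rule coeff_0_poly_plus)
    then have "1 \<le> j" using that by (cases j) (auto simp: J_def)
    then show ?thesis using Nil by (simp add: monom_in_poly_plus)
  qed (use Cons.prems(1) in simp)
  have "mqz (map (monom 1) ss @ g # gs) =
      (\<Sum>j\<in>J. fps_const (coeff g j) * mqz (map (monom 1) ss @ monom 1 j # gs))"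
    using mqz_lincomb[OF fin, of "map (monom 1) ss" "monom 1" gs "coeff g", OF hd]
    by (simp only: g[symmetric])
  also have "\<dots> \<in> V"
  proof (intro fps_rat.subspace_sum[OF V] fps_rat.subspace_scale[OF V])
    fix j assume j: "j \<in> J"
    have "mqz (map (monom 1) (ss @ [j]) @ gs) \<in> V"
    proof (rule Cons.IH)
      show "hd (map (monom 1) (ss @ [j]) @ gs @ [monom 1 1]) \<in> poly_plus"
        using hd[OF j, of "gs @ [monom 1 1]"] by simp
      fix ts assume "list_all2 (\<lambda>t g. t \<le> degree g \<and> coeff g t \<noteq> 0) ts gs"
      then show "mqz_mon ((ss @ [j]) @ ts) \<in> V"
        using Cons.prems(2)[of "j # ts"] j by (simp add: J_def)
    qed
    then show "mqz (map (monom 1) ss @ monom 1 j # gs) \<in> V" by simp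
  qed
  finally show ?case .
qed

text \<open>A nonzero coefficient rules out k = 0, where only the zero polynomial is allowed; hence
  the 1 in the maximum.\<close>

lemma coeff_W_poly:
  assumes "f \<in> W_poly k" "t \<le> degree f" "coeff f t \<noteq> 0"
  shows "max 1 t \<le> k"
  using assms by (auto simp: W_poly_def split: if_splits)

lemma coeff_W_poly_plus:
  assumes "f \<in> W_poly_plus k" "t \<le> degree f" "coeff f t \<noteq> 0"
  shows "1 \<le> t \<and> t \<le> k"
proof -
  have "t \<noteq> 0" using assms coeff_0_poly_plus[of f] unfolding W_poly_plus_def by (metis IntD1)
  then show ?thesis using coeff_W_poly[of f k t] assms by (auto simp: W_poly_plus_def)
qed

lemma monom_in_W_poly: "monom 1 t \<in> W_poly (max 1 t)"
  by (simp add: W_poly_def degree_monom_eq)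

lemma monom_in_W_poly_plus: "1 \<le> t \<Longrightarrow> monom 1 t \<in> W_poly_plus t"
  by (simp add: W_poly_plus_def W_poly_def degree_monom_eq monom_in_poly_plus)

lemma sum_list_le_list_all2: "list_all2 (\<le>) xs ys \<Longrightarrow> sum_list xs \<le> (sum_list ys :: nat)"
  by (induction rule: list_all2_induct) auto

text \<open>Expanding a tensor gives words with positive entries of sum at most n; conversely the
  words in 1 and 2 that span the right side are themselves such tensors.\<close>

lemma W_Zreg_plus_eq: "W_Zreg_plus n = ratfun (qpoch n)"
proof
  show "W_Zreg_plus n \<subseteq> ratfun (qpoch n)"
    unfolding W_Zreg_plus_def
  proof (rule fps_rat.span_minimal[OF _ subspace_ratfun], safe)
    show "1 \<in> ratfun (qpoch n)" using mqz_mon_in_ratfun_qpoch[of "[]" n] by simp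
  next
    fix fs "is" assume fs: "fs \<noteq> []" "list_all2 (\<lambda>f i. f \<in> W_poly_plus i) fs is" "sum_list is \<le> n"
    have "mqz (map (monom 1) [] @ fs) \<in> ratfun (qpoch n)"
    proof (rule mqz_in_subspaceI[OF subspace_ratfun])
      show "hd (map (monom 1) [] @ fs @ [monom 1 1]) \<in> poly_plus"
        using fs by (cases fs) (auto simp: list_all2_Cons1 W_poly_plus_def)
      fix ts assume "list_all2 (\<lambda>t f. t \<le> degree f \<and> coeff f t \<noteq> 0) ts fs"
      from list_all2_trans[OF _ this fs(2), of "\<lambda>t i. 1 \<le> t \<and> t \<le> i"] coeff_W_poly_plus
      have *: "list_all2 (\<lambda>t i. 1 \<le> t \<and> t \<le> i) ts is" by blast
      then have "sum_list ts \<le> sum_list is"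
        by (intro sum_list_le_list_all2) (auto elim: list_all2_mono)
      moreover have "\<forall>t\<in>set ts. 1 \<le> t" using * by (auto simp: list_all2_conv_all_nth in_set_conv_nth)
      ultimately show "mqz_mon ([] @ ts) \<in> ratfun (qpoch n)"
        using fs(3) by (simp add: mqz_mon_in_ratfun_qpoch)
    qed
    then show "mqz fs \<in> ratfun (qpoch n)" by simp
  qed
  show "ratfun (qpoch n) \<subseteq> W_Zreg_plus n"
    unfolding ratfun_qpoch mqz12_le_def
  proof (rule fps_rat.span_minimal, safe)
    fix s :: "nat list" assume s: "set s \<subseteq> {1, 2}" "sum_list s \<le> n"
    show "mqz_mon s \<in> W_Zreg_plus n"
    proof (cases "s = []")
      case True
      then show ?thesis by (simp add: W_Zreg_plus_def fps_rat.span_base)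
    next
      case False
      have "list_all2 (\<lambda>f i. f \<in> W_poly_plus i) (map (monom 1) s) s"
        using s(1) monom_in_W_poly_plus by (auto simp: list_all2_map1 list_all2_same)
      then show ?thesis
        unfolding W_Zreg_plus_def mqz_mon_def using False s(2)
        by (intro fps_rat.span_base insertI2 CollectI exI[of _ "map (monom 1) s"] exI[of _ s]) simp
    qed
  qed (simp add: W_Zreg_plus_def)
qed

lemma W_Zreg_eq: "W_Zreg n = ratfun (cyc_tower n)"
proof
  show "W_Zreg n \<subseteq> ratfun (cyc_tower n)"
    unfolding W_Zreg_def
  proof (rule fps_rat.span_minimal[OF _ subspace_ratfun], safe)
    show "1 \<in> ratfun (cyc_tower n)" unfolding ratfun_cyc_tower by (rule one_in_mqz_wt_le)
  next
    fix f fs i "is"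
    assume f: "f \<in> W_poly_plus i" and fs: "list_all2 (\<lambda>f i. f \<in> W_poly i) fs is"
      and le: "i + sum_list is \<le> n"
    have "mqz (map (monom 1) [] @ f # fs) \<in> ratfun (cyc_tower n)"
    proof (rule mqz_in_subspaceI[OF subspace_ratfun])
      show "hd (map (monom 1) [] @ (f # fs) @ [monom 1 1]) \<in> poly_plus"
        using f by (simp add: W_poly_plus_def)
      fix us assume "list_all2 (\<lambda>t f. t \<le> degree f \<and> coeff f t \<noteq> 0) us (f # fs)"
      then obtain t ts where us: "us = t # ts" "t \<le> degree f" "coeff f t \<noteq> 0"
          and ts: "list_all2 (\<lambda>t f. t \<le> degree f \<and> coeff f t \<noteq> 0) ts fs"
        by (auto simp: list_all2_Cons2)
      from list_all2_trans[OF _ ts fs, of "\<lambda>t i. max 1 t \<le> i"] coeff_W_poly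
      have "list_all2 (\<lambda>t i. max 1 t \<le> i) ts is" by blast
      then have "sum_list (map (max 1) ts) \<le> sum_list is"
        by (intro sum_list_le_list_all2) (simp only: list_all2_map1)
      moreover have "1 \<le> t" "t \<le> i" using coeff_W_poly_plus[OF f us(2,3)] by auto
      ultimately show "mqz_mon ([] @ us) \<in> ratfun (cyc_tower n)"
        using le by (intro mqz_mon_in_ratfun_cyc_tower) (auto simp: us(1) mqz_wt_def)
    qed
    then show "mqz (f # fs) \<in> ratfun (cyc_tower n)" by simp
  qed
  show "ratfun (cyc_tower n) \<subseteq> W_Zreg n"
    unfolding ratfun_cyc_tower mqz_wt_le_def
  proof (rule fps_rat.span_minimal)
    show "{mqz_mon s |s. (s \<noteq> [] \<longrightarrow> 1 \<le> hd s) \<and> mqz_wt s \<le> n} \<subseteq> W_Zreg n"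
    proof
      fix g assume "g \<in> {mqz_mon s |s. (s \<noteq> [] \<longrightarrow> 1 \<le> hd s) \<and> mqz_wt s \<le> n}"
      then obtain s where s: "g = mqz_mon s" "s \<noteq> [] \<longrightarrow> 1 \<le> hd s" "mqz_wt s \<le> n" by blast
      show "g \<in> W_Zreg n"
      proof (cases s)
        case Nil
        then show ?thesis by (simp add: s(1) W_Zreg_def fps_rat.span_base)
      next
        case (Cons t ts)
        have "list_all2 (\<lambda>f i. f \<in> W_poly i) (map (monom 1) ts) (map (max 1) ts)"
          using monom_in_W_poly by (auto simp: list_all2_map1 list_all2_map2 list_all2_same)
        moreover have "monom 1 t \<in> W_poly_plus t" "t + sum_list (map (max 1) ts) \<le> n"
          using s Cons monom_in_W_poly_plus[of t] by (auto simp: mqz_wt_def)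
        ultimately show ?thesis
          unfolding W_Zreg_def s(1) mqz_mon_def Cons list.map by (intro fps_rat.span_base insertI2) blast
      qed
    qed
  qed (simp add: W_Zreg_def)
qed

section \<open>Equality of the two algebras, products and generators\<close>

lemma ratfun_qpoch_subset_span12: "ratfun (qpoch n) \<subseteq> fps_rat.span {mqz_mon s |s. set s \<subseteq> {1, 2}}"
  unfolding ratfun_qpoch mqz12_le_def by (intro fps_rat.span_mono) auto

lemma Zreg_plus_eq_span12: "Zreg_plus = fps_rat.span {mqz_mon s |s. set s \<subseteq> {1, 2}}"
proof
  show "Zreg_plus \<subseteq> fps_rat.span {mqz_mon s |s. set s \<subseteq> {1, 2}}"
    unfolding Zreg_plus_def
  proof (rule fps_rat.span_minimal, safe)
    fix s :: "nat list" assume "\<forall>i\<in>set s. 1 \<le> i"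
    then have "mqz_mon s \<in> ratfun (qpoch (sum_list s))" by (rule mqz_mon_in_ratfun_qpoch) simp
    then show "mqz_mon s \<in> fps_rat.span {mqz_mon s |s. set s \<subseteq> {1, 2}}"
      using ratfun_qpoch_subset_span12 by blast
  qed
  show "fps_rat.span {mqz_mon s |s. set s \<subseteq> {1, 2}} \<subseteq> Zreg_plus"
    unfolding Zreg_plus_def by (intro fps_rat.span_mono) fastforce
qed

lemma subspace_Zreg_plus: "fps_rat.subspace Zreg_plus"
  by (simp add: Zreg_plus_def)

lemma one_in_Zreg_plus: "1 \<in> Zreg_plus"
  unfolding Zreg_plus_def by (intro fps_rat.span_base CollectI exI[of _ "[]"]) simp

text \<open>Among the factors 1 - q^i with i \<le> d k there are k whose index is a multiple of d,
  each divisible by \<open>cyc d\<close>.\<close>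

lemma cyc_power_dvd_qpoch: "0 < d \<Longrightarrow> cyc d ^ k dvd qpoch (d * k)"
proof (induction k)
  case (Suc k)
  have "cyc d dvd 1 - monom 1 (d * Suc k)"
    by (rule dvd_trans[OF cyc_dvd[OF Suc.prems] one_minus_monom_dvd[OF dvd_triv_left]])
  then have "cyc d ^ k * cyc d dvd qpoch (d * k) * (1 - monom 1 (d * Suc k))"
    by (intro mult_dvd_mono Suc.IH[OF Suc.prems])
  also have "\<dots> dvd qpoch (d * Suc k)" using Suc.prems by (intro qpoch_mult_dvd) auto
  finally show ?case unfolding power_Suc2 .
qed simp

lemma ratfun_cyc_prod_power_subset: "ratfun (cyc_prod n ^ k) \<subseteq> Zreg_plus"
  unfolding cyc_prod_def prod_power_distrib
proof (rule ratfun_prod_cyc_subset[OF subspace_Zreg_plus one_in_Zreg_plus])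
  fix d :: nat assume "0 < d"
  then have "ratfun (cyc d ^ k) \<subseteq> ratfun (qpoch (d * k))"
    by (intro ratfun_mono cyc_power_dvd_qpoch qpoch_nz)
  then show "ratfun (cyc d ^ k) \<subseteq> Zreg_plus"
    using ratfun_qpoch_subset_span12 Zreg_plus_eq_span12 by blast
qed

lemma mqz_mon_in_ratfun_cyc_prod_power:
  assumes "s \<noteq> [] \<longrightarrow> 1 \<le> hd s"
  shows "mqz_mon s \<in> ratfun (cyc_prod (mqz_wt s) ^ mqz_wt s)"
  using mqz_mon_in_ratfun_cyc_tower[OF assms order_refl]
    ratfun_mono[OF cyc_tower_dvd_power, of "mqz_wt s"] cyc_prod_nz by auto

text \<open>A word with zeros is a fraction over a power of some \<open>cyc_prod\<close>. Partial
  fractions leave denominators \<open>cyc d ^ k\<close>, which divide some \<open>qpoch\<close>, so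
  words without zeros reach it, though perhaps in higher weight.\<close>

lemma Zreg_plus_eq_Zreg: "Zreg_plus = Zreg"
proof
  show "Zreg_plus \<subseteq> Zreg"
    unfolding Zreg_plus_def Zreg_def by (intro fps_rat.span_mono) fastforce
  show "Zreg \<subseteq> Zreg_plus"
    unfolding Zreg_def
  proof (rule fps_rat.span_minimal[OF _ subspace_Zreg_plus])
    show "{mqz_mon s |s. s \<noteq> [] \<longrightarrow> 1 \<le> hd s} \<subseteq> Zreg_plus"
      using mqz_mon_in_ratfun_cyc_prod_power ratfun_cyc_prod_power_subset by blast
  qed
qed

text \<open>Fractions over powers of \<open>cyc_prod\<close> are closed under products once both
  denominators are raised to the larger index.\<close>

lemma Zreg_plus_mult:
  assumes "f \<in> Zreg_plus" "g \<in> Zreg_plus"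
  shows "f * g \<in> Zreg_plus"
proof -
  have *: "mqz_mon s * mqz_mon t \<in> Zreg_plus"
    if "s \<noteq> [] \<longrightarrow> 1 \<le> hd s" "t \<noteq> [] \<longrightarrow> 1 \<le> hd t" for s t
  proof -
    let ?a = "mqz_wt s" and ?b = "mqz_wt t"
    let ?m = "max ?a ?b"
    have "mqz_mon s * mqz_mon t \<in> ratfun (cyc_prod ?a ^ ?a * cyc_prod ?b ^ ?b)"
      using that cyc_prod_nz by (intro ratfun_mult mqz_mon_in_ratfun_cyc_prod_power) auto
    also have "\<dots> \<subseteq> ratfun (cyc_prod ?m ^ (?a + ?b))"
      unfolding power_add using cyc_prod_nz
      by (intro ratfun_mono mult_dvd_mono dvd_power_same cyc_prod_dvd) auto
    also have "\<dots> \<subseteq> Zreg_plus" by (rule ratfun_cyc_prod_power_subset)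
    finally show ?thesis .
  qed
  have "g * f \<in> Zreg_plus"
    using assms(1) unfolding Zreg_plus_eq_Zreg[unfolded Zreg_def]
  proof (rule span_mult_left)
    fix h assume "h \<in> {mqz_mon s |s. s \<noteq> [] \<longrightarrow> 1 \<le> hd s}"
    then obtain s where s: "h = mqz_mon s" "s \<noteq> [] \<longrightarrow> 1 \<le> hd s" by blast
    have "h * g \<in> Zreg_plus"
      using assms(2) unfolding Zreg_plus_eq_Zreg[unfolded Zreg_def]
      by (rule span_mult_left) (use * s in \<open>auto simp: Zreg_plus_eq_Zreg[unfolded Zreg_def]\<close>)
    then show "g * h \<in> fps_rat.span {mqz_mon s |s. s \<noteq> [] \<longrightarrow> 1 \<le> hd s}"
      unfolding Zreg_plus_eq_Zreg[unfolded Zreg_def] by (simp only: mult.commute[of g h])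
  qed simp
  then show ?thesis by (simp only: mult.commute[of f g])
qed

lemma xq_in_Zreg_plus: "0 < k \<Longrightarrow> xq k \<in> Zreg_plus"
  using mqz_mon_snoc_xq[of "[]" k] unfolding Zreg_plus_def
  by (intro fps_rat.span_base CollectI exI[of _ "[k]"]) simp

text \<open>Words of length 1 are the generators, and every word is a product of generators by
  \<open>mqz_mon_snoc_xq\<close>.\<close>

lemma Zreg_plus_eq_hull: "Zreg_plus = is_subalgebra hull {fps_X ^ k / (1 - fps_X ^ k) |k. 1 \<le> k}"
proof (rule hull_unique[symmetric])
  show "{fps_X ^ k / (1 - fps_X ^ k) |k. 1 \<le> k} \<subseteq> Zreg_plus"
    using xq_in_Zreg_plus unfolding xq_def by auto
  show "is_subalgebra Zreg_plus"
    by (simp add: is_subalgebra_def subspace_Zreg_plus one_in_Zreg_plus Zreg_plus_mult)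
next
  fix A :: "rat fps set"
  assume gen: "{fps_X ^ k / (1 - fps_X ^ k) |k. 1 \<le> k} \<subseteq> A" and A: "is_subalgebra A"
  have "mqz_mon s \<in> A" if "\<forall>i\<in>set s. 1 \<le> i" for s
    using that
  proof (induction s rule: rev_induct)
    case Nil
    then show ?case using A by (simp add: is_subalgebra_def)
  next
    case (snoc a s)
    have hd: "1 \<le> hd (s @ [a])" using snoc.prems by (cases s) auto
    have "1 \<le> sum_list (s @ [a])" using snoc.prems by simp
    then have "xq (sum_list (s @ [a])) \<in> A" using gen unfolding xq_def by blast
    moreover have "mqz_mon s \<in> A" using snoc by simp
    ultimately show ?case unfolding mqz_mon_snoc_xq[OF hd] using A by (simp add: is_subalgebra_def)
  qed
  then show "Zreg_plus \<subseteq> A"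
    using A unfolding Zreg_plus_def is_subalgebra_def by (intro fps_rat.span_minimal) auto
qed

section \<open>Graded dimensions and generating series\<close>

lemma quotient_dim_ratfun:
  assumes "coeff F 0 \<noteq> 0" "E dvd F"
  shows "fps_rat.quotient_dim (ratfun F) (ratfun E) = degree F - degree E"
proof -
  have "F \<noteq> 0" using assms(1) by (metis coeff_0)
  have "coeff E 0 \<noteq> 0" using assms by (auto simp: coeff_mult_0)
  have "fps_rat.quotient_dim (ratfun F) (ratfun E) + fps_rat.dim (ratfun E) = fps_rat.dim (ratfun F)"
    by (rule fps_rat.quotient_dim_plus_dim[OF subspace_ratfun subspace_ratfun
        ratfun_mono[OF assms(2) \<open>F \<noteq> 0\<close>] _ equalityD1[OF ratfun_basis(1)[OF assms(1)]]]) simp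
  then show ?thesis using ratfun_basis(2) assms(1) \<open>coeff E 0 \<noteq> 0\<close> by simp
qed

text \<open>The start of the filtration, where W_{-1} = 0 and the extra 1 in the dimension does not
  cancel.\<close>

lemma quotient_dim_ratfun_0:
  assumes "coeff F 0 \<noteq> 0"
  shows "fps_rat.quotient_dim (ratfun F) {0} = degree F + 1"
proof -
  have "{0} \<subseteq> ratfun F" using fps_rat.subspace_0[OF subspace_ratfun] by simp
  then have "fps_rat.quotient_dim (ratfun F) {0} + fps_rat.dim {0} = fps_rat.dim (ratfun F)"
    by (intro fps_rat.quotient_dim_plus_dim[OF fps_rat.subspace_single_0 subspace_ratfun
        _ _ equalityD1[OF ratfun_basis(1)[OF assms]]]) simp_all
  moreover have "fps_rat.dim {0} = 0"
    using fps_rat.dim_unique[of "{}" "{0}" 0] fps_rat.independent_empty by simp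
  ultimately show ?thesis using ratfun_basis(2)[OF assms] by simp
qed

lemma quotient_dim_W_Zreg_plus:
  "fps_rat.quotient_dim (W_Zreg_plus i) (if i = 0 then {0} else W_Zreg_plus (i - 1)) = (if i = 0 then 1 else i)"
proof (cases i)
  case 0
  then show ?thesis using quotient_dim_ratfun_0[OF coeff_0_qpoch[of 0]] by (simp add: W_Zreg_plus_eq)
next
  case (Suc n)
  have "fps_rat.quotient_dim (ratfun (qpoch (Suc n))) (ratfun (qpoch n)) = Suc n"
    using quotient_dim_ratfun[OF coeff_0_qpoch qpoch_dvd[of n "Suc n"]]
    by (simp add: degree_qpoch numeral_2_eq_2)
  then show ?thesis by (simp add: Suc W_Zreg_plus_eq)
qed

lemma quotient_dim_W_Zreg:
  "fps_rat.quotient_dim (W_Zreg i) (if i = 0 then {0} else W_Zreg (i - 1)) =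
    (if i = 0 then 1 else \<Sum>d\<in>{1..i}. totient d)"
proof (cases i)
  case 0
  then show ?thesis using quotient_dim_ratfun_0[OF coeff_0_cyc_tower[of 0]] by (simp add: W_Zreg_eq)
next
  case (Suc n)
  have "fps_rat.quotient_dim (ratfun (cyc_tower (Suc n))) (ratfun (cyc_tower n)) = (\<Sum>d\<in>{1..Suc n}. totient d)"
    using quotient_dim_ratfun[OF coeff_0_cyc_tower cyc_tower_dvd[of n "Suc n"]]
    by (simp add: degree_cyc_tower)
  then show ?thesis by (simp add: Suc W_Zreg_eq)
qed

lemma poincare_series_W_Zreg_plus:
  "poincare_series W_Zreg_plus = 1 + Abs_fps (\<lambda>d. if 1 \<le> d then of_nat d else 0)"
  unfolding poincare_series_def quotient_dim_W_Zreg_plus by (rule fps_ext) simp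

text \<open>Multiplication by the geometric series turns the totients into their partial sums, which
  are the graded dimensions in positive weight.\<close>

lemma poincare_series_W_Zreg:
  "poincare_series W_Zreg =
     1 + 1 / (1 - fps_X) * Abs_fps (\<lambda>d. if 1 \<le> d then of_nat (totient d) else 0)"
proof (rule fps_ext)
  fix n
  let ?a = "\<lambda>d. if 1 \<le> d then of_nat (totient d) else (0 :: rat)"
  have "(1 :: rat fps) / (1 - fps_X) = Abs_fps (\<lambda>_. 1)"
    by (subst fps_divide_unit) (simp_all add: fps_inverse_one_minus_fps_X)
  then have "fps_nth (1 / (1 - fps_X) * Abs_fps ?a) n = (\<Sum>d\<in>{0..n}. ?a d)"
    by (simp add: fps_mult_nth mult.commute[of "Abs_fps (\<lambda>_. 1)"])
  also have "\<dots> = (\<Sum>d\<in>{1..n}. of_nat (totient d))"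
    by (rule sum.mono_neutral_cong_right) auto
  finally show "fps_nth (poincare_series W_Zreg) n = fps_nth (1 + 1 / (1 - fps_X) * Abs_fps ?a) n"
    unfolding poincare_series_def quotient_dim_W_Zreg by simp
qed

lemma one_plus_Abs_fps_of_nat:
  "1 + Abs_fps (\<lambda>d. if 1 \<le> d then of_nat d else 0) =
    ((1 - fps_X + fps_X ^ 2) / (1 - fps_X) ^ 2 :: rat fps)"
    (is "?P = ?N / ?D")
proof -
  let ?S = "Abs_fps (\<lambda>n. of_nat (n + 1)) :: rat fps"
  have D0: "fps_nth ?D 0 \<noteq> 0" by (simp add: fps_nth_power_0)
  have inv: "inverse ?D = ?S" by (rule fps_one_over_one_minus_fps_X_squared)
  have DS: "?D * ?S = 1" using inverse_mult_eq_1'[OF D0] unfolding inv .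
  \<comment> \<open>With 1 - t + t^2 = (1 - t)^2 + t the quotient becomes 1 + t / (1 - t)^2, whose
    coefficients are known.\<close>
  have N: "?N = ?D + fps_X" by (simp add: power2_eq_square algebra_simps)
  have "?N / ?D = (?D + fps_X) * ?S" unfolding fps_divide_unit[OF D0] inv N ..
  also have "\<dots> = 1 + fps_X * ?S" by (simp only: distrib_right DS)
  also have "\<dots> = 1 + Abs_fps (\<lambda>d. if 1 \<le> d then of_nat d else 0)"
    by (rule fps_ext) (simp add: fps_X_mult_nth of_nat_diff)
  finally show ?thesis ..
qed

theorem theorem2:
  "(Zreg_plus = Zreg \<and>
     Zreg_plus = is_subalgebra hull {fps_X ^ k / (1 - fps_X ^ k) |k. 1 \<le> k}) \<and>
   (poincare_series W_Zreg_plus = 1 + Abs_fps (\<lambda>d. if 1 \<le> d then of_nat d else 0) \<and>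
     poincare_series W_Zreg_plus = (1 - fps_X + fps_X ^ 2) / (1 - fps_X) ^ 2) \<and>
   poincare_series W_Zreg =
     1 + 1 / (1 - fps_X) * Abs_fps (\<lambda>d. if 1 \<le> d then of_nat (totient d) else 0) \<and>
   Zreg_plus = fps_rat.span {mqz_mon s |s. set s \<subseteq> {1, 2}}"
  using Zreg_plus_eq_Zreg Zreg_plus_eq_hull poincare_series_W_Zreg_plus one_plus_Abs_fps_of_nat
    poincare_series_W_Zreg Zreg_plus_eq_span12 by (simp only: simp_thms)

end
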